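(* Let $V$ be a Banach space. The following conditions are equivalent: (1) $V$ is a Rosenthal Banach space. (2) $(\Theta(V)^{op},B^* )$ is a tame system. (3) $p:B^*\to B^*$ is a fragmented map for each $p\in\mathcal{E}(V)$. (4) $\mathcal{E}(V)$ is a tame semigroup.
   Context: Banach spaces are real. A Banach space is Rosenthal if it does not contain an isomorphic copy of $l_1$. $\Theta(V)$ is the semigroup of all linear operators $T:V\to V$ with $\|T\|\le1$. $B^*$ is the closed unit ball of $V^*$ with the weak$^*$ topology. $\Theta(V)^{op}$ (the opposite semigroup, with the weak operator topology) is identified with $\{T^*:T\in\Theta(V)\}$ and acts from the left on $B^*$; this action is separately continuous. For a compact Hausdorff space $X$ with a separately continuous action of a semitopological monoid $S$, the enveloping semigroup $E(X)=E(S,X)$ is the pointwise closure in $X^X$ of the set of translations $x\mapsto sx$ ($s\in S$). $\mathcal{E}(V):=E(\Theta(V)^{op},B^* )$; its operation is composition. A map $f:X\to Y$ from a topological space $X$ to a uniform space $Y$ is fragmented if for every nonempty $A\subset X$ and every entourage $\varepsilon$ of $Y$ there is an open $O\subset X$ such that $O\cap A\neq\emptyset$ and $f(O\cap A)$ is $\varepsilon$-small (i.e. $f(O\cap A)\times f(O\cap A)\subset\varepsilon$). Compact spaces carry their unique compatible uniformity. A compact $S$-system $X$ is tame if every $p\in E(X)$ is a fragmented map $X\to X$. A semigroup $P$ with a topology is right topological if all right translations $x\mapsto xa$ are continuous; it is admissible if moreover $\Lambda(P)=\{a\in P: x\mapsto ax \text{ is continuous}\}$ is dense in $P$. $\mathcal{E}(V)$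 is a compact admissible right topological semigroup. A compact admissible right topological semigroup $P$ is tame if for every $a\in P$ the left translation $\lambda_a:P\to P$, $x\mapsto ax$, is a fragmented map. *)

theory Defs
  imports "HOL-Analysis.Analysis"
begin

typedef l1 = "{x :: nat \<Rightarrow> real. summable (\<lambda>n. \<bar>x n\<bar>)}"
  morphisms l1_nth Abs_l1
  by (rule exI[of _ "\<lambda>_. 0"]) simp

setup_lifting type_definition_l1

lemma summable_l1_nth: "summable (\<lambda>n. \<bar>l1_nth x n\<bar>)"
  using l1_nth[of x] by simp

lemma summable_abs_add:
  fixes x y :: "nat \<Rightarrow> real"
  assumes "summable (\<lambda>n. \<bar>x n\<bar>)" "summable (\<lambda>n. \<bar>y n\<bar>)"
  shows "summable (\<lambda>n. \<bar>x n + y n\<bar>)"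
  by (rule summable_comparison_test'[OF summable_add[OF assms], of 0]) auto

lemma summable_abs_diff:
  fixes x y :: "nat \<Rightarrow> real"
  assumes "summable (\<lambda>n. \<bar>x n\<bar>)" "summable (\<lambda>n. \<bar>y n\<bar>)"
  shows "summable (\<lambda>n. \<bar>x n - y n\<bar>)"
  by (rule summable_comparison_test'[OF summable_add[OF assms], of 0]) auto

instantiation l1 :: real_normed_vector
begin

lift_definition zero_l1 :: l1 is "\<lambda>_. 0" by simp
lift_definition plus_l1 :: "l1 \<Rightarrow> l1 \<Rightarrow> l1" is "\<lambda>x y n. x n + y n"
  by (rule summable_abs_add)
lift_definition minus_l1 :: "l1 \<Rightarrow> l1 \<Rightarrow> l1" is "\<lambda>x y n. x n - y n"
  by (rule summable_abs_diff)
lift_definition uminus_l1 :: "l1 \<Rightarrow> l1" is "\<lambda>x n. - x n" by simp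
lift_definition scaleR_l1 :: "real \<Rightarrow> l1 \<Rightarrow> l1" is "\<lambda>c x n. c * x n"
  by (simp add: abs_mult summable_mult)
lift_definition norm_l1 :: "l1 \<Rightarrow> real" is "\<lambda>x. \<Sum>n. \<bar>x n\<bar>" .

definition dist_l1 :: "l1 \<Rightarrow> l1 \<Rightarrow> real"
  where "dist_l1 x y = norm (x - y)"
definition uniformity_l1 :: "(l1 \<times> l1) filter"
  where "uniformity_l1 = (INF e\<in>{0<..}. principal {(x, y). dist x y < e})"
definition open_l1 :: "l1 set \<Rightarrow> bool"
  where "open_l1 U = (\<forall>x\<in>U. eventually (\<lambda>(x', y). x' = x \<longrightarrow> y \<in> U) uniformity)"
definition sgn_l1 :: "l1 \<Rightarrow> l1"
  where "sgn_l1 x = inverse (norm x) *\<^sub>R x"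

instance
proof
  fix x y z :: l1 and a b :: real
  show "x + y + z = x + (y + z)" "x + y = y + x" "0 + x = x" "- x + x = 0" "x - y = x + - y"
    by (transfer; simp add: algebra_simps)+
  show "a *\<^sub>R (x + y) = a *\<^sub>R x + a *\<^sub>R y" "(a + b) *\<^sub>R x = a *\<^sub>R x + b *\<^sub>R x"
    "a *\<^sub>R b *\<^sub>R x = (a * b) *\<^sub>R x" "1 *\<^sub>R x = x"
    by (transfer; simp add: algebra_simps)+
  show "norm x = 0 \<longleftrightarrow> x = 0"
    by transfer (auto simp: suminf_eq_zero_iff)
  show "norm (x + y) \<le> norm x + norm y"
  proof transfer
    fix x y :: "nat \<Rightarrow> real"
    assume *: "summable (\<lambda>n. \<bar>x n\<bar>)" "summable (\<lambda>n. \<bar>y n\<bar>)"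
    have "(\<Sum>n. \<bar>x n + y n\<bar>) \<le> (\<Sum>n. \<bar>x n\<bar> + \<bar>y n\<bar>)"
      by (intro suminf_le summable_abs_add summable_add *) auto
    then show "(\<Sum>n. \<bar>x n + y n\<bar>) \<le> (\<Sum>n. \<bar>x n\<bar>) + (\<Sum>n. \<bar>y n\<bar>)"
      by (simp add: suminf_add *)
  qed
  show "norm (a *\<^sub>R x) = \<bar>a\<bar> * norm x"
    by transfer (simp add: abs_mult suminf_mult)
qed (simp_all add: dist_l1_def uniformity_l1_def open_l1_def sgn_l1_def)

end

definition contains_l1 :: "'a::real_normed_vector itself \<Rightarrow> bool"
  where "contains_l1 _ \<longleftrightarrow>
    (\<exists>(J :: l1 \<Rightarrow> 'a) K. linear J \<and> homeomorphism UNIV (range J) J K)"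

definition rosenthal_space :: "'a::banach itself \<Rightarrow> bool"
  where "rosenthal_space V \<longleftrightarrow> \<not> contains_l1 V"

definition uniformity_on :: "'y set \<Rightarrow> ('y \<times> 'y) set set \<Rightarrow> bool"
  where "uniformity_on Y \<U> \<longleftrightarrow>
    Y \<times> Y \<in> \<U> \<and>
    (\<forall>E\<in>\<U>. Id_on Y \<subseteq> E \<and> E \<subseteq> Y \<times> Y) \<and>
    (\<forall>E\<in>\<U>. \<forall>F. E \<subseteq> F \<and> F \<subseteq> Y \<times> Y \<longrightarrow> F \<in> \<U>) \<and>
    (\<forall>E\<in>\<U>. \<forall>F\<in>\<U>. E \<inter> F \<in> \<U>) \<and>
    (\<forall>E\<in>\<U>. E\<inverse> \<in> \<U>) \<and>
    (\<forall>E\<in>\<U>. \<exists>D\<in>\<U>. D O D \<subseteq> E)"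

definition compatible_uniformity :: "'y topology \<Rightarrow> ('y \<times> 'y) set set \<Rightarrow> bool"
  where "compatible_uniformity Y \<U> \<longleftrightarrow>
    uniformity_on (topspace Y) \<U> \<and>
    (\<forall>G. openin Y G \<longleftrightarrow> G \<subseteq> topspace Y \<and> (\<forall>x\<in>G. \<exists>E\<in>\<U>. E `` {x} \<subseteq> G))"

text \<open>Only meaningful for compact Hausdorff spaces; existence and uniqueness are
  \<open>ex1_compatible_uniformity\<close> below.\<close>

definition compact_uniformity :: "'y topology \<Rightarrow> ('y \<times> 'y) set set"
  where "compact_uniformity Y = (THE \<U>. compatible_uniformity Y \<U>)"

text \<open>Since entourages are subsets of \<open>Y \<times> Y\<close>, a fragmented map necessarily maps \<open>X\<close> into \<open>Y\<close>.\<close>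

definition fragmented :: "'x topology \<Rightarrow> ('y \<times> 'y) set set \<Rightarrow> ('x \<Rightarrow> 'y) \<Rightarrow> bool"
  where "fragmented X \<U> f \<longleftrightarrow>
    (\<forall>A \<epsilon>. A \<noteq> {} \<and> A \<subseteq> topspace X \<and> \<epsilon> \<in> \<U> \<longrightarrow>
      (\<exists>G. openin X G \<and> G \<inter> A \<noteq> {} \<and> f ` (G \<inter> A) \<times> f ` (G \<inter> A) \<subseteq> \<epsilon>))"

definition semitopological_monoid :: "'s topology \<Rightarrow> ('s \<Rightarrow> 's \<Rightarrow> 's) \<Rightarrow> 's \<Rightarrow> bool"
  where "semitopological_monoid S mul e \<longleftrightarrow>
    e \<in> topspace S \<and>
    (\<forall>a\<in>topspace S. mul e a = a \<and> mul a e = a) \<and>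
    (\<forall>a\<in>topspace S. \<forall>b\<in>topspace S. \<forall>c\<in>topspace S. mul (mul a b) c = mul a (mul b c)) \<and>
    (\<forall>a\<in>topspace S. continuous_map S S (mul a) \<and> continuous_map S S (\<lambda>x. mul x a))"

definition compact_system ::
    "'s topology \<Rightarrow> ('s \<Rightarrow> 's \<Rightarrow> 's) \<Rightarrow> 's \<Rightarrow> 'x topology \<Rightarrow> ('s \<Rightarrow> 'x \<Rightarrow> 'x) \<Rightarrow> bool"
  where "compact_system S mul e X act \<longleftrightarrow>
    semitopological_monoid S mul e \<and> compact_space X \<and> Hausdorff_space X \<and>
    (\<forall>x\<in>topspace X. act e x = x) \<and>
    (\<forall>s\<in>topspace S. \<forall>t\<in>topspace S. \<forall>x\<in>topspace X. act (mul s t) x = act s (act t x)) \<and>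
    (\<forall>s\<in>topspace S. continuous_map X X (act s)) \<and>
    (\<forall>x\<in>topspace X. continuous_map S X (\<lambda>s. act s x))"

text \<open>\<open>X\<^sup>X\<close> consists of the functions that are \<open>undefined\<close> outside \<open>topspace X\<close>, with the topology
  of pointwise convergence.\<close>

abbreviation self_maps :: "'x topology \<Rightarrow> ('x \<Rightarrow> 'x) topology"
  where "self_maps X \<equiv> product_topology (\<lambda>_. X) (topspace X)"

definition enveloping_semigroup :: "'s set \<Rightarrow> 'x topology \<Rightarrow> ('s \<Rightarrow> 'x \<Rightarrow> 'x) \<Rightarrow> ('x \<Rightarrow> 'x) set"
  where "enveloping_semigroup S X act =
    self_maps X closure_of ((\<lambda>s. restrict (act s) (topspace X)) ` S)"

definition tame_system ::
    "'s topology \<Rightarrow> ('s \<Rightarrow> 's \<Rightarrow> 's) \<Rightarrow> 's \<Rightarrow> 'x topology \<Rightarrow> ('s \<Rightarrow> 'x \<Rightarrow> 'x) \<Rightarrow> bool"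
  where "tame_system S mul e X act \<longleftrightarrow>
    compact_system S mul e X act \<and>
    (\<forall>p\<in>enveloping_semigroup (topspace S) X act. fragmented X (compact_uniformity X) p)"

definition right_topological_semigroup :: "'p topology \<Rightarrow> ('p \<Rightarrow> 'p \<Rightarrow> 'p) \<Rightarrow> bool"
  where "right_topological_semigroup P mul \<longleftrightarrow>
    (\<forall>a\<in>topspace P. \<forall>b\<in>topspace P. mul a b \<in> topspace P) \<and>
    (\<forall>a\<in>topspace P. \<forall>b\<in>topspace P. \<forall>c\<in>topspace P. mul (mul a b) c = mul a (mul b c)) \<and>
    (\<forall>a\<in>topspace P. continuous_map P P (\<lambda>x. mul x a))"

definition admissible_semigroup :: "'p topology \<Rightarrow> ('p \<Rightarrow> 'p \<Rightarrow> 'p) \<Rightarrow> bool"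
  where "admissible_semigroup P mul \<longleftrightarrow>
    right_topological_semigroup P mul \<and>
    P closure_of {a \<in> topspace P. continuous_map P P (mul a)} = topspace P"

text \<open>Compactness includes the Hausdorff property, as needed for the uniformity on \<open>P\<close> to exist
  and be unique.\<close>

definition tame_semigroup :: "'p topology \<Rightarrow> ('p \<Rightarrow> 'p \<Rightarrow> 'p) \<Rightarrow> bool"
  where "tame_semigroup P mul \<longleftrightarrow>
    compact_space P \<and> Hausdorff_space P \<and> admissible_semigroup P mul \<and>
    (\<forall>a\<in>topspace P. fragmented P (compact_uniformity P) (mul a))"

text \<open>For functionals the strong operator topology is the topology of pointwise convergence.\<close>

definition weak_star_topology :: "('a::real_normed_vector \<Rightarrow>\<^sub>L real) topology"
  where "weak_star_topology = strong_operator_topology"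

definition dual_ball :: "('a::real_normed_vector \<Rightarrow>\<^sub>L real) topology"
  where "dual_ball = subtopology weak_star_topology (cball 0 1)"

definition weak_operator_topology :: "('a::real_normed_vector \<Rightarrow>\<^sub>L 'b::real_normed_vector) topology"
  where "weak_operator_topology =
    pullback_topology UNIV (\<lambda>T (v, f :: 'b \<Rightarrow>\<^sub>L real). blinfun_apply f (blinfun_apply T v)) euclidean"

text \<open>\<open>Theta\<close> carries the semigroup \<open>\<Theta>(V)\<close> and its opposite alike; the opposite multiplication is
  \<open>Theta_op_mult\<close>.  The operator \<open>T\<close> acts on functionals as its adjoint \<open>T\<^sup>*\<close>.\<close>

definition Theta :: "('a::real_normed_vector \<Rightarrow>\<^sub>L 'a) topology"
  where "Theta = subtopology weak_operator_topology {T. norm T \<le> 1}"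

definition Theta_op_mult ::
    "('a::real_normed_vector \<Rightarrow>\<^sub>L 'a) \<Rightarrow> ('a \<Rightarrow>\<^sub>L 'a) \<Rightarrow> ('a \<Rightarrow>\<^sub>L 'a)"
  where "Theta_op_mult S T = T o\<^sub>L S"

definition adjoint_action ::
    "('a::real_normed_vector \<Rightarrow>\<^sub>L 'a) \<Rightarrow> ('a \<Rightarrow>\<^sub>L real) \<Rightarrow> ('a \<Rightarrow>\<^sub>L real)"
  where "adjoint_action T f = f o\<^sub>L T"

text \<open>The enveloping semigroup \<open>\<E>(V)\<close> is a semigroup under \<open>compose (topspace dual_ball)\<close>; the
  structural conjuncts of \<open>tame_system\<close> and \<open>tame_semigroup\<close> always hold for it and for the action
  on the dual ball, see \<open>compact_system_Theta_op\<close> and \<open>env_semigroup_admissible\<close>.\<close>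

definition env_semigroup ::
    "'a::real_normed_vector itself \<Rightarrow> (('a \<Rightarrow>\<^sub>L real) \<Rightarrow> ('a \<Rightarrow>\<^sub>L real)) set"
  where "env_semigroup _ = enveloping_semigroup (topspace Theta) dual_ball adjoint_action"

definition env_topology ::
    "'a::real_normed_vector itself \<Rightarrow> (('a \<Rightarrow>\<^sub>L real) \<Rightarrow> ('a \<Rightarrow>\<^sub>L real)) topology"
  where "env_topology V = subtopology (self_maps dual_ball) (env_semigroup V)"

lemma uniformity_onD:
  assumes "uniformity_on Y \<U>"
  shows "Y \<times> Y \<in> \<U>"
    and "E \<in> \<U> \<Longrightarrow> Id_on Y \<subseteq> E"
    and "E \<in> \<U> \<Longrightarrow> E \<subseteq> Y \<times> Y"
    and "E \<in> \<U> \<Longrightarrow> E \<subseteq> F \<Longrightarrow> F \<subseteq> Y \<times> Y \<Longrightarrow> F \<in> \<U>"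
    and "E \<in> \<U> \<Longrightarrow> F \<in> \<U> \<Longrightarrow> E \<inter> F \<in> \<U>"
    and "E \<in> \<U> \<Longrightarrow> E\<inverse> \<in> \<U>"
    and "E \<in> \<U> \<Longrightarrow> \<exists>D\<in>\<U>. D O D \<subseteq> E"
  using assms unfolding uniformity_on_def by meson+

lemma compatible_entourage_nbhd:
  assumes U: "compatible_uniformity Y \<U>" and E: "E \<in> \<U>"
  shows "\<exists>W. openin (prod_topology Y Y) W \<and> Id_on (topspace Y) \<subseteq> W \<and> W \<subseteq> E"
proof -
  have u: "uniformity_on (topspace Y) \<U>"
    and op: "\<And>G. openin Y G \<longleftrightarrow> G \<subseteq> topspace Y \<and> (\<forall>x\<in>G. \<exists>E\<in>\<U>. E `` {x} \<subseteq> G)"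
    using U by (auto simp: compatible_uniformity_def)
  obtain D where D: "D \<in> \<U>" "D O D \<subseteq> E" using uniformity_onD(7)[OF u] E by meson
  define F where "F = D \<inter> D\<inverse>"
  have F: "F \<in> \<U>"
    unfolding F_def using D uniformity_onD(5,6)[OF u] by blast
  define I where "I x = {y \<in> topspace Y. \<exists>G\<in>\<U>. G `` {y} \<subseteq> F `` {x}}" for x
  have Iop: "openin Y (I x)" for x
    unfolding op
  proof (intro conjI ballI)
    show "I x \<subseteq> topspace Y" by (auto simp: I_def)
    fix y assume "y \<in> I x"
    then obtain G where G: "G \<in> \<U>" "G `` {y} \<subseteq> F `` {x}" by (auto simp: I_def)
    obtain H where H: "H \<in> \<U>" "H O H \<subseteq> G" using uniformity_onD(7)[OF u] G by meson
    have "H `` {y} \<subseteq> I x"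
    proof
      fix z assume z: "z \<in> H `` {y}"
      have "H \<subseteq> topspace Y \<times> topspace Y" using uniformity_onD(3)[OF u] H by blast
      then show "z \<in> I x" using z H G unfolding I_def by blast
    qed
    then show "\<exists>E\<in>\<U>. E `` {y} \<subseteq> I x" using H by blast
  qed
  have IF: "I x \<subseteq> F `` {x}" for x
  proof
    fix y assume y: "y \<in> I x"
    then obtain G where G: "G \<in> \<U>" "G `` {y} \<subseteq> F `` {x}" "y \<in> topspace Y" by (auto simp: I_def)
    have "Id_on (topspace Y) \<subseteq> G" using uniformity_onD(2)[OF u] G by blast
    then show "y \<in> F `` {x}" using G by blast
  qed
  define W where "W = (\<Union>x\<in>topspace Y. I x \<times> I x)"
  have "openin (prod_topology Y Y) W"
    unfolding W_def by (intro openin_Union) (auto simp: openin_prod_Times_iff Iop)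
  moreover have "Id_on (topspace Y) \<subseteq> W"
    using F uniformity_onD(1)[OF u] unfolding W_def I_def by blast
  moreover have "W \<subseteq> E"
    using IF D(2) unfolding W_def F_def by blast
  ultimately show ?thesis by blast
qed

lemma nbhd_compatible_entourage:
  assumes U: "compatible_uniformity Y \<U>" and cpt: "compact_space Y"
    and W: "openin (prod_topology Y Y) W" "Id_on (topspace Y) \<subseteq> W"
  shows "W \<in> \<U>"
proof -
  have u: "uniformity_on (topspace Y) \<U>"
    and op: "\<And>G. openin Y G \<longleftrightarrow> G \<subseteq> topspace Y \<and> (\<forall>x\<in>G. \<exists>E\<in>\<U>. E `` {x} \<subseteq> G)"
    using U by (auto simp: compatible_uniformity_def)
  have "\<exists>G D I. openin Y G \<and> G \<times> G \<subseteq> W \<and> D \<in> \<U> \<and> (D O D) `` {x} \<subseteq> G \<and>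
          openin Y I \<and> x \<in> I \<and> I \<subseteq> D `` {x}" if x: "x \<in> topspace Y" for x
  proof -
    have "(x, x) \<in> W" using W x by blast
    then obtain G1 G2 where "openin Y G1" "openin Y G2" "x \<in> G1" "x \<in> G2" "G1 \<times> G2 \<subseteq> W"
      using W(1) unfolding openin_prod_topology_alt by meson
    then have G: "openin Y (G1 \<inter> G2)" "x \<in> G1 \<inter> G2" "(G1 \<inter> G2) \<times> (G1 \<inter> G2) \<subseteq> W" by auto
    then obtain E where E: "E \<in> \<U>" "E `` {x} \<subseteq> G1 \<inter> G2" using op by blast
    obtain D where D: "D \<in> \<U>" "D O D \<subseteq> E" using uniformity_onD(7)[OF u] E by meson
    obtain V where V: "openin (prod_topology Y Y) V" "Id_on (topspace Y) \<subseteq> V" "V \<subseteq> D"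
      using compatible_entourage_nbhd[OF U D(1)] by blast
    have "(x, x) \<in> V" using V x by blast
    then obtain I1 I2 where I: "openin Y I1" "openin Y I2" "x \<in> I1" "x \<in> I2" "I1 \<times> I2 \<subseteq> V"
      using V(1) unfolding openin_prod_topology_alt by meson
    have "(D O D) `` {x} \<subseteq> G1 \<inter> G2" "I2 \<subseteq> D `` {x}" using D E I V by blast+
    then show ?thesis using G D I by blast
  qed
  then obtain G D I where *: "\<And>x. x \<in> topspace Y \<Longrightarrow> openin Y (G x) \<and> G x \<times> G x \<subseteq> W \<and> D x \<in> \<U> \<and>
      (D x O D x) `` {x} \<subseteq> G x \<and> openin Y (I x) \<and> x \<in> I x \<and> I x \<subseteq> D x `` {x}" by metis
  have "\<exists>\<F>. finite \<F> \<and> \<F> \<subseteq> I ` topspace Y \<and> topspace Y \<subseteq> \<Union>\<F>"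
    using cpt[unfolded compact_space_alt, rule_format, of "I ` topspace Y"] * by blast
  then obtain K where K: "finite K" "K \<subseteq> topspace Y" "topspace Y \<subseteq> \<Union>(I ` K)"
    by (metis finite_subset_image)
  define N where "N = (topspace Y \<times> topspace Y) \<inter> (\<Inter>x\<in>K. D x)"
  have "(topspace Y \<times> topspace Y) \<inter> (\<Inter>x\<in>K. D x) \<in> \<U>"
    using K(1,2)
  proof (induction K)
    case empty
    then show ?case using u by (simp add: uniformity_on_def)
  next
    case (insert x K)
    have "D x \<inter> ((topspace Y \<times> topspace Y) \<inter> (\<Inter>x\<in>K. D x)) \<in> \<U>"
    proof (rule uniformity_onD(5)[OF u])
      show "D x \<in> \<U>" using insert.prems *[of x] by blast
      show "(topspace Y \<times> topspace Y) \<inter> (\<Inter>x\<in>K. D x) \<in> \<U>" using insert.IH insert.prems by blast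
    qed
    then show ?case by (simp add: Int_left_commute)
  qed
  then have N: "N \<in> \<U>" by (simp add: N_def)
  have "N \<subseteq> W"
  proof (clarify)
    fix y z assume yz: "(y, z) \<in> N"
    then have "y \<in> topspace Y" by (auto simp: N_def)
    then obtain x where x: "x \<in> K" "y \<in> I x" using K by blast
    have xx: "x \<in> topspace Y" using x K by blast
    have 1: "(x, y) \<in> D x" "(y, z) \<in> D x" using x *[OF xx] yz by (auto simp: N_def)
    have "(y, y) \<in> D x"
      using uniformity_onD(2)[OF u, of "D x"] *[OF xx] \<open>y \<in> topspace Y\<close> by blast
    then have "y \<in> G x" "z \<in> G x" using 1 *[OF xx] by blast+
    then show "(y, z) \<in> W" using *[OF xx] by blast
  qed
  moreover have "W \<subseteq> topspace Y \<times> topspace Y" using openin_subset[OF W(1)] by simp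
  ultimately show ?thesis using uniformity_onD(4)[OF u N] by blast
qed

lemma compatible_uniformity_nbhds:
  assumes cpt: "compact_space Y" and H: "Hausdorff_space Y"
  shows "compatible_uniformity Y {E. E \<subseteq> topspace Y \<times> topspace Y \<and>
    (\<exists>W. openin (prod_topology Y Y) W \<and> Id_on (topspace Y) \<subseteq> W \<and> W \<subseteq> E)}"
    (is "compatible_uniformity Y ?U")
proof -
  have UI: "E \<in> ?U" if "openin (prod_topology Y Y) W" "Id_on (topspace Y) \<subseteq> W" "W \<subseteq> E"
    "E \<subseteq> topspace Y \<times> topspace Y" for E W
    using that by blast
  have UI': "W \<in> ?U" if "openin (prod_topology Y Y) W" "Id_on (topspace Y) \<subseteq> W" for W
    by (rule UI[OF that subset_refl])
      (use openin_subset[OF that(1)] in \<open>simp only: topspace_prod_topology\<close>)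
  have UE: "\<exists>W. openin (prod_topology Y Y) W \<and> Id_on (topspace Y) \<subseteq> W \<and> W \<subseteq> E"
    "E \<subseteq> topspace Y \<times> topspace Y" if "E \<in> ?U" for E
    using that by (simp_all only: mem_Collect_eq)
  have comp: "\<exists>D\<in>?U. D O D \<subseteq> E" if E: "E \<in> ?U" for E
  proof -
    obtain W where W: "openin (prod_topology Y Y) W" "Id_on (topspace Y) \<subseteq> W" "W \<subseteq> E"
      using UE(1)[OF E] by (elim exE conjE)
    have reg: "regular_space Y" using cpt H compact_Hausdorff_imp_regular_space by blast
    have "\<exists>G C V. openin Y G \<and> G \<times> G \<subseteq> W \<and> closedin Y C \<and> openin Y V \<and> x \<in> V \<and> V \<subseteq> C \<and> C \<subseteq> G"
      if x: "x \<in> topspace Y" for x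
    proof -
      have "(x, x) \<in> W" using W x by blast
      then obtain G1 G2 where "openin Y G1" "openin Y G2" "x \<in> G1" "x \<in> G2" "G1 \<times> G2 \<subseteq> W"
        using W(1) unfolding openin_prod_topology_alt by meson
      then have G: "openin Y (G1 \<inter> G2)" "x \<in> G1 \<inter> G2" "(G1 \<inter> G2) \<times> (G1 \<inter> G2) \<subseteq> W" by auto
      then obtain V C where "openin Y V" "closedin Y C" "x \<in> V" "V \<subseteq> C" "C \<subseteq> G1 \<inter> G2"
        using reg unfolding neighbourhood_base_of_closedin[symmetric] neighbourhood_base_of
        by meson
      then show ?thesis using G by blast
    qed
    then obtain G C V where *: "\<And>x. x \<in> topspace Y \<Longrightarrow> openin Y (G x) \<and> G x \<times> G x \<subseteq> W \<and>
        closedin Y (C x) \<and> openin Y (V x) \<and> x \<in> V x \<and> V x \<subseteq> C x \<and> C x \<subseteq> G x" by metis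
    have "\<exists>\<F>. finite \<F> \<and> \<F> \<subseteq> V ` topspace Y \<and> topspace Y \<subseteq> \<Union>\<F>"
      using cpt[unfolded compact_space_alt, rule_format, of "V ` topspace Y"] * by blast
    then obtain K where K: "finite K" "K \<subseteq> topspace Y" "topspace Y \<subseteq> \<Union>(V ` K)"
      by (metis finite_subset_image)
    define N where "N x = G x \<times> G x \<union> (topspace Y - C x) \<times> (topspace Y - C x)" for x
    define D where "D = (topspace Y \<times> topspace Y) \<inter> (\<Inter>x\<in>K. N x)"
    have Nop: "openin (prod_topology Y Y) (N x)" if "x \<in> K" for x
    proof -
      have "openin Y (G x)" "openin Y (topspace Y - C x)" using * that K by blast+
      then show ?thesis unfolding N_def by (intro openin_Un) (simp_all add: openin_prod_Times_iff)
    qed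
    have "openin (prod_topology Y Y) ((topspace Y \<times> topspace Y) \<inter> (\<Inter>x\<in>K. N x))"
      using K(1) Nop
    proof (induction K)
      case empty
      then show ?case by (simp add: openin_prod_Times_iff)
    next
      case (insert x K)
      have "openin (prod_topology Y Y) (N x \<inter> ((topspace Y \<times> topspace Y) \<inter> (\<Inter>x\<in>K. N x)))"
        by (rule openin_Int) (use insert in blast)+
      then show ?case by (simp add: Int_left_commute)
    qed
    then have Dop: "openin (prod_topology Y Y) D" by (simp add: D_def)
    have "(y, y) \<in> D" if y: "y \<in> topspace Y" for y
    proof -
      have "(y, y) \<in> N x" if "x \<in> K" for x
      proof -
        have "C x \<subseteq> G x" using * that K(2) by blast
        then show ?thesis using y unfolding N_def by blast
      qed
      then show ?thesis using y unfolding D_def by blast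
    qed
    then have "Id_on (topspace Y) \<subseteq> D" by blast
    then have "D \<in> ?U" using Dop by (intro UI')
    moreover have "D O D \<subseteq> W"
    proof (clarify)
      fix y z w assume yz: "(y, z) \<in> D" "(z, w) \<in> D"
      then have "z \<in> topspace Y" by (auto simp: D_def)
      then obtain x where x: "x \<in> K" "z \<in> V x" using K by blast
      then have "z \<in> C x" using * K by blast
      then have "y \<in> G x" "w \<in> G x" using yz x(1) by (auto simp: D_def N_def)
      then show "(y, w) \<in> W" using * K x by blast
    qed
    ultimately show ?thesis using W(3) by (meson subset_trans)
  qed
  have inv: "E\<inverse> \<in> ?U" if E: "E \<in> ?U" for E
  proof -
    obtain W where W: "openin (prod_topology Y Y) W" "Id_on (topspace Y) \<subseteq> W" "W \<subseteq> E"
      using UE(1)[OF E] by (elim exE conjE)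
    have "openin (prod_topology Y Y) (W\<inverse>)"
      unfolding openin_prod_topology_alt
    proof (intro allI impI)
      fix x y assume "(x, y) \<in> W\<inverse>"
      then obtain G1 G2 where "openin Y G1" "openin Y G2" "y \<in> G1" "x \<in> G2" "G1 \<times> G2 \<subseteq> W"
        using W(1) unfolding openin_prod_topology_alt by (metis converseD)
      then show "\<exists>U V. openin Y U \<and> openin Y V \<and> x \<in> U \<and> y \<in> V \<and> U \<times> V \<subseteq> W\<inverse>"
        by (intro exI[of _ G2] exI[of _ G1]) auto
    qed
    then show ?thesis
      by (rule UI) (use W UE(2)[OF E] in blast)+
  qed
  have int: "E \<inter> F \<in> ?U" if E: "E \<in> ?U" and F: "F \<in> ?U" for E F
  proof -
    obtain W where W: "openin (prod_topology Y Y) W" "Id_on (topspace Y) \<subseteq> W" "W \<subseteq> E"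
      using UE(1)[OF E] by (elim exE conjE)
    obtain W' where W': "openin (prod_topology Y Y) W'" "Id_on (topspace Y) \<subseteq> W'" "W' \<subseteq> F"
      using UE(1)[OF F] by (elim exE conjE)
    have "openin (prod_topology Y Y) (W \<inter> W')" using W W' by blast
    then show ?thesis
      by (rule UI) (use W W' UE(2)[OF E] in blast)+
  qed
  have top: "topspace Y \<times> topspace Y \<in> ?U"
    by (rule UI') (auto simp: openin_prod_Times_iff)
  have "uniformity_on (topspace Y) ?U"
    unfolding uniformity_on_def
  proof (intro conjI ballI allI impI)
    fix E F assume E: "E \<in> ?U" and F: "E \<subseteq> F \<and> F \<subseteq> topspace Y \<times> topspace Y"
    then obtain W where W: "openin (prod_topology Y Y) W" "Id_on (topspace Y) \<subseteq> W" "W \<subseteq> E"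
      using UE(1)[OF E] by (elim exE conjE)
    show "F \<in> ?U" by (rule UI[OF W(1,2)]) (use W(3) F in blast)+
  next
    fix E assume E: "E \<in> ?U"
    show "Id_on (topspace Y) \<subseteq> E" using UE(1)[OF E] by (elim exE conjE) (rule subset_trans)
    show "E \<subseteq> topspace Y \<times> topspace Y" using UE(2)[OF E] .
  qed (fact top int inv comp)+
  moreover have "openin Y G \<longleftrightarrow> G \<subseteq> topspace Y \<and> (\<forall>x\<in>G. \<exists>E\<in>?U. E `` {x} \<subseteq> G)" for G
  proof
    assume G: "openin Y G"
    show "G \<subseteq> topspace Y \<and> (\<forall>x\<in>G. \<exists>E\<in>?U. E `` {x} \<subseteq> G)"
    proof (intro conjI ballI)
      show "G \<subseteq> topspace Y" using G openin_subset by blast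
      fix x assume x: "x \<in> G"
      then have xY: "x \<in> topspace Y" using G openin_subset by blast
      define W where "W = topspace Y \<times> G \<union> (topspace Y - {x}) \<times> topspace Y"
      have "closedin Y {x}" using H xY by (simp add: closedin_Hausdorff_sing_eq)
      then have "openin Y (topspace Y - {x})" by blast
      then have Wop: "openin (prod_topology Y Y) W"
        unfolding W_def using G by (intro openin_Un) (auto simp: openin_prod_Times_iff)
      moreover have "Id_on (topspace Y) \<subseteq> W" using x by (auto simp: W_def)
      ultimately have "W \<in> ?U" by (rule UI')
      moreover have "W `` {x} \<subseteq> G" by (auto simp: W_def)
      ultimately show "\<exists>E\<in>?U. E `` {x} \<subseteq> G" by (rule bexI[rotated])
    qed
  next
    assume R: "G \<subseteq> topspace Y \<and> (\<forall>x\<in>G. \<exists>E\<in>?U. E `` {x} \<subseteq> G)"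
    show "openin Y G"
    proof (subst openin_subopen, intro ballI)
      fix x assume x: "x \<in> G"
      then obtain W where W: "openin (prod_topology Y Y) W" "Id_on (topspace Y) \<subseteq> W" "W `` {x} \<subseteq> G"
        using R UE(1) by (meson Image_mono subset_refl subset_trans)
      have "(x, x) \<in> W" using W x R by blast
      then obtain G1 G2 where "openin Y G1" "openin Y G2" "x \<in> G1" "x \<in> G2" "G1 \<times> G2 \<subseteq> W"
        using W(1) unfolding openin_prod_topology_alt by meson
      then show "\<exists>T. openin Y T \<and> x \<in> T \<and> T \<subseteq> G" using W(3) by blast
    qed
  qed
  ultimately show ?thesis unfolding compatible_uniformity_def by (intro conjI allI)
qed

lemma ex1_compatible_uniformity:
  assumes "compact_space Y" "Hausdorff_space Y"
  shows "\<exists>!\<U>. compatible_uniformity Y \<U>"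
proof -
  have "\<U> \<subseteq> \<V>" if U: "compatible_uniformity Y \<U>" and V: "compatible_uniformity Y \<V>" for \<U> \<V>
  proof
    fix E assume E: "E \<in> \<U>"
    then obtain W where W: "openin (prod_topology Y Y) W" "Id_on (topspace Y) \<subseteq> W" "W \<subseteq> E"
      using compatible_entourage_nbhd[OF U] by blast
    have "E \<subseteq> topspace Y \<times> topspace Y"
      using U E uniformity_onD(3)[of "topspace Y" \<U> E] by (simp add: compatible_uniformity_def)
    moreover have "uniformity_on (topspace Y) \<V>"
      using V unfolding compatible_uniformity_def by blast
    ultimately show "E \<in> \<V>"
      using uniformity_onD(4)[OF _ nbhd_compatible_entourage[OF V assms(1) W(1,2)] W(3)] by blast
  qed
  then show ?thesis using compatible_uniformity_nbhds[OF assms] by (meson subset_antisym)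
qed

lemma compact_uniformity_eq:
  assumes "compact_space Y" "Hausdorff_space Y"
  shows "compact_uniformity Y = {E. E \<subseteq> topspace Y \<times> topspace Y \<and>
    (\<exists>W. openin (prod_topology Y Y) W \<and> Id_on (topspace Y) \<subseteq> W \<and> W \<subseteq> E)}"
  unfolding compact_uniformity_def
  by (rule the1_equality[OF ex1_compatible_uniformity[OF assms] compatible_uniformity_nbhds[OF assms]])

lemma enveloping_semigroup_admissible:
  assumes sys: "compact_system S mul e X act"
  defines "E \<equiv> enveloping_semigroup (topspace S) X act"
  defines "P \<equiv> subtopology (self_maps X) E"
  shows "compact_space P" "Hausdorff_space P" "admissible_semigroup P (compose (topspace X))"
proof -
  have cX: "compact_space X" and hX: "Hausdorff_space X"
    and ac: "\<And>s. s \<in> topspace S \<Longrightarrow> continuous_map X X (act s)"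
    and am: "\<And>s t x. s \<in> topspace S \<Longrightarrow> t \<in> topspace S \<Longrightarrow> x \<in> topspace X \<Longrightarrow>
               act (mul s t) x = act s (act t x)"
    and mon: "semitopological_monoid S mul e"
    using sys unfolding compact_system_def by blast+
  have mul: "mul s t \<in> topspace S" if st: "s \<in> topspace S" "t \<in> topspace S" for s t
  proof -
    have "continuous_map S S (mul s)" using mon st unfolding semitopological_monoid_def by blast
    then show ?thesis using st(2) continuous_map_funspace by blast
  qed
  define J where "J = (\<lambda>s. restrict (act s) (topspace X)) ` topspace S"
  have actX: "act s x \<in> topspace X" if "s \<in> topspace S" "x \<in> topspace X" for s x
    using continuous_map_funspace[OF ac[OF that(1)]] that(2) by blast
  have topF: "topspace (self_maps X) = topspace X \<rightarrow>\<^sub>E topspace X" by simp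
  have JF: "J \<subseteq> topspace (self_maps X)"
    unfolding topF J_def using actX by auto
  have E: "E = self_maps X closure_of J" by (simp add: E_def J_def enveloping_semigroup_def)
  have Ecl: "closedin (self_maps X) E" by (simp add: E)
  have JE: "J \<subseteq> E" unfolding E by (rule closure_of_subset[OF JF])
  have EF: "E \<subseteq> topspace X \<rightarrow>\<^sub>E topspace X" using closedin_subset[OF Ecl] by simp
  have tP: "topspace P = E" unfolding P_def using closedin_subset[OF Ecl] by auto
  have "compact_space (self_maps X)" by (simp add: compact_space_product_topology cX)
  then show "compact_space P"
    unfolding P_def using Ecl by (metis closedin_compact_space compact_space_subtopology)
  have "Hausdorff_space (self_maps X)" by (simp add: Hausdorff_space_product_topology hX)
  then show "Hausdorff_space P" unfolding P_def by (rule Hausdorff_space_subtopology)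
  have L: "continuous_map (self_maps X) (self_maps X) (compose (topspace X) g)"
    if g: "continuous_map X X g" for g
    unfolding continuous_map_componentwise
  proof (intro conjI ballI)
    show "compose (topspace X) g ` topspace (self_maps X) \<subseteq> extensional (topspace X)" by auto
    fix k assume k: "k \<in> topspace X"
    have "continuous_map (self_maps X) X (g \<circ> (\<lambda>x. x k))"
      by (rule continuous_map_compose[OF continuous_map_product_projection[OF k] g])
    then show "continuous_map (self_maps X) X (\<lambda>x. compose (topspace X) g x k)"
      using k by (simp add: compose_def o_def)
  qed
  have R: "continuous_map (self_maps X) (self_maps X) (\<lambda>x. compose (topspace X) x a)"
    if a: "a \<in> topspace X \<rightarrow>\<^sub>E topspace X" for a
    unfolding continuous_map_componentwise
  proof (intro conjI ballI)
    show "(\<lambda>x. compose (topspace X) x a) ` topspace (self_maps X) \<subseteq> extensional (topspace X)" by auto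
    fix k assume k: "k \<in> topspace X"
    then have "a k \<in> topspace X" using a by auto
    then have "continuous_map (self_maps X) X (\<lambda>x. x (a k))"
      by (rule continuous_map_product_projection)
    then show "continuous_map (self_maps X) X (\<lambda>x. compose (topspace X) x a k)"
      using k by (simp add: compose_def)
  qed
  have J1: "compose (topspace X) j q = compose (topspace X) (act s) q"
    if "j = restrict (act s) (topspace X)" "q \<in> topspace X \<rightarrow>\<^sub>E topspace X" for j s q
    unfolding compose_def by (rule restrict_ext) (use that in auto)
  have JEE: "compose (topspace X) j q \<in> E" if j: "j \<in> J" and q: "q \<in> E" for j q
  proof -
    obtain s where s: "s \<in> topspace S" "j = restrict (act s) (topspace X)"
      using j by (auto simp: J_def)
    have "compose (topspace X) (act s) ` J \<subseteq> J"
    proof (clarsimp simp: J_def)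
      fix t assume t: "t \<in> topspace S"
      have "compose (topspace X) (act s) (restrict (act t) (topspace X)) =
            restrict (act (mul s t)) (topspace X)"
        unfolding compose_def by (rule restrict_ext) (simp add: am s t)
      then show "compose (topspace X) (act s) (restrict (act t) (topspace X)) \<in>
          (\<lambda>s. restrict (act s) (topspace X)) ` topspace S" using mul[OF s(1) t] by blast
    qed
    then have "compose (topspace X) (act s) ` E \<subseteq> E"
      unfolding E using continuous_map_image_closure_subset[OF L[OF ac[OF s(1)]], of J]
        closure_of_mono by (metis (no_types, lifting) subset_trans)
    moreover have "compose (topspace X) j q = compose (topspace X) (act s) q"
      using J1[OF s(2)] q EF by blast
    ultimately show ?thesis using q by (simp add: image_subset_iff)
  qed
  have EEE: "compose (topspace X) p q \<in> E" if p: "p \<in> E" and q: "q \<in> E" for p q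
  proof -
    have "(\<lambda>x. compose (topspace X) x q) ` J \<subseteq> E" using JEE q by blast
    moreover have "(\<lambda>x. compose (topspace X) x q) ` (self_maps X closure_of J)
        \<subseteq> self_maps X closure_of ((\<lambda>x. compose (topspace X) x q) ` J)"
      using q EF by (intro continuous_map_image_closure_subset R) blast
    ultimately have "(\<lambda>x. compose (topspace X) x q) ` E \<subseteq> E"
      using closure_of_minimal[OF _ Ecl] unfolding E by (metis (no_types, lifting) subset_trans)
    then show ?thesis using p by blast
  qed
  have cont: "continuous_map P P f" if "continuous_map (self_maps X) (self_maps X) f" "f ` E \<subseteq> E" for f
    unfolding P_def using that
    by (auto simp: continuous_map_in_subtopology continuous_map_from_subtopology)
  have "right_topological_semigroup P (compose (topspace X))"
    unfolding right_topological_semigroup_def tP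
  proof (intro conjI ballI)
    fix a b assume "a \<in> E" "b \<in> E"
    then show "compose (topspace X) a b \<in> E" by (rule EEE)
  next
    fix a b c assume "a \<in> E" "b \<in> E" "c \<in> E"
    then have "c \<in> topspace X \<rightarrow> topspace X" using EF by auto
    then show "compose (topspace X) (compose (topspace X) a b) c =
               compose (topspace X) a (compose (topspace X) b c)"
      by (rule compose_assoc[symmetric])
  next
    fix a assume a: "a \<in> E"
    show "continuous_map P P (\<lambda>x. compose (topspace X) x a)"
      using a EF EEE by (intro cont R) auto
  qed
  moreover have "P closure_of {a \<in> topspace P. continuous_map P P (compose (topspace X) a)} = topspace P"
  proof -
    have "J \<subseteq> {a \<in> topspace P. continuous_map P P (compose (topspace X) a)}"
    proof
      fix j assume j: "j \<in> J"
      obtain s where s: "s \<in> topspace S" "j = restrict (act s) (topspace X)"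
        using j by (auto simp: J_def)
      have "continuous_map X X j"
        using ac[OF s(1)] continuous_map_eq s(2) by fastforce
      then have "continuous_map P P (compose (topspace X) j)"
        using JEE[OF j] by (intro cont L) auto
      then show "j \<in> {a \<in> topspace P. continuous_map P P (compose (topspace X) a)}"
        using j JE tP by blast
    qed
    moreover have "P closure_of J = E"
      unfolding P_def closure_of_subtopology using JE E by (simp add: Int_absorb1)
    ultimately show ?thesis
      using closure_of_mono closure_of_subset_topspace tP by (metis subset_antisym)
  qed
  ultimately show "admissible_semigroup P (compose (topspace X))"
    unfolding admissible_semigroup_def by blast
qed

lemma topspace_dual_ball: "topspace dual_ball = cball 0 1"
  by (simp add: dual_ball_def weak_star_topology_def strong_operator_topology_topspace)

lemma continuous_map_dual_ball:
  "continuous_map T dual_ball f \<longleftrightarrow>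
    (\<forall>y\<in>topspace T. norm (f y) \<le> 1) \<and> (\<forall>v. continuous_map T euclidean (\<lambda>y. blinfun_apply (f y) v))"
  unfolding dual_ball_def weak_star_topology_def continuous_map_in_subtopology
    continuous_on_strong_operator_topo_iff_coordinatewise
  by (simp add: image_subset_iff conj_commute Pi_iff)

lemma compact_dual_ball: "compact_space (dual_ball :: ('a::real_normed_vector \<Rightarrow>\<^sub>L real) topology)"
proof -
  define K :: "('a \<Rightarrow> real) set" where
    "K = {g. (\<forall>x y. g (x + y) = g x + g y) \<and> (\<forall>c x. g (c *\<^sub>R x) = c *\<^sub>R g x) \<and> (\<forall>x. \<bar>g x\<bar> \<le> norm x)}"
  have "closed K"
    unfolding K_def
    by (intro closed_Collect_conj closed_Collect_all closed_Collect_eq closed_Collect_le continuous_intros)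
       (auto intro!: continuous_on_product_coordinates continuous_intros)
  moreover have "compact (PiE UNIV (\<lambda>x::'a. {- norm x..norm x}))"
    using compactin_PiE[of "\<lambda>_. euclideanreal" UNIV "\<lambda>x::'a. {- norm x..norm x}"]
    by (simp add: euclidean_product_topology)
  ultimately have "compact (PiE UNIV (\<lambda>x::'a. {- norm x..norm x}) \<inter> K)"
    by (rule compact_Int_closed[rotated])
  moreover have "PiE UNIV (\<lambda>x::'a. {- norm x..norm x}) \<inter> K = K"
    by (auto simp: K_def abs_le_iff minus_le_iff)
  ultimately have cK: "compactin (top_of_set K) K"
    by (simp add: compactin_subtopology)
  have bl: "bounded_linear g" if "g \<in> K" for g
    using that by (intro bounded_linear_intro[of _ 1]) (auto simp: K_def)
  have "continuous_map (top_of_set K) dual_ball Blinfun"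
    unfolding continuous_map_dual_ball
  proof (intro conjI ballI allI)
    fix g assume "g \<in> topspace (top_of_set K)"
    then have "g \<in> K" by simp
    then show "norm (Blinfun g) \<le> 1"
      by (intro norm_blinfun_bound) (auto simp: bounded_linear_Blinfun_apply bl K_def)
  next
    fix v
    have "continuous_on K (\<lambda>g. g v)" by (rule continuous_on_subset[OF continuous_on_product_coordinates]) simp
    then show "continuous_map (top_of_set K) euclidean (\<lambda>g. blinfun_apply (Blinfun g) v)"
      by (auto simp: bounded_linear_Blinfun_apply bl cong: continuous_on_cong)
  qed
  then have "compactin dual_ball (Blinfun ` K)"
    by (rule image_compactin[OF cK])
  moreover have "Blinfun ` K = topspace dual_ball"
  proof (intro subset_antisym subsetI)
    fix f assume "f \<in> Blinfun ` K"
    then show "f \<in> topspace dual_ball" using \<open>compactin dual_ball (Blinfun ` K)\<close> compactin_subset_topspace by blast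
  next
    fix f :: "'a \<Rightarrow>\<^sub>L real" assume "f \<in> topspace dual_ball"
    then have n: "norm f \<le> 1" by (simp add: topspace_dual_ball)
    have "\<bar>blinfun_apply f x\<bar> \<le> norm x" for x
      using norm_blinfun[of f x] mult_right_mono[OF n norm_ge_zero[of x]] by simp
    then have "blinfun_apply f \<in> K" by (simp add: K_def blinfun.add_right blinfun.scaleR_right)
    then show "f \<in> Blinfun ` K" by (metis blinfun_apply_inverse image_eqI)
  qed
  ultimately show ?thesis by (simp add: compact_space_def)
qed

lemma Hausdorff_dual_ball: "Hausdorff_space (dual_ball :: ('a::real_normed_vector \<Rightarrow>\<^sub>L real) topology)"
  unfolding Hausdorff_space_def
proof (intro allI impI)
  fix f g :: "'a \<Rightarrow>\<^sub>L real"
  assume fg: "f \<in> topspace dual_ball \<and> g \<in> topspace dual_ball \<and> f \<noteq> g"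
  then have "f \<noteq> g" by simp
  then obtain v where v: "blinfun_apply f v \<noteq> blinfun_apply g v"
    by (meson blinfun_eqI)
  then obtain A B where AB: "open A" "open B" "blinfun_apply f v \<in> A" "blinfun_apply g v \<in> B" "A \<inter> B = {}"
    using hausdorff[OF v] by (elim exE conjE)
  have c: "continuous_map dual_ball euclidean (\<lambda>h. blinfun_apply h v)"
    using continuous_map_dual_ball[of dual_ball "\<lambda>h :: 'a \<Rightarrow>\<^sub>L real. h"] by simp
  define U where "U C = {h \<in> topspace (dual_ball :: ('a \<Rightarrow>\<^sub>L real) topology). blinfun_apply h v \<in> C}" for C
  have "openin dual_ball (U C)" if "open C" for C
    unfolding U_def using openin_continuous_map_preimage[OF c] that by simp
  then show "\<exists>U V. openin dual_ball U \<and> openin dual_ball V \<and> f \<in> U \<and> g \<in> V \<and> disjnt U V"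
    using AB fg by (intro exI[of _ "U A"] exI[of _ "U B"]) (auto simp: U_def disjnt_def)
qed

lemma topspace_Theta: "topspace Theta = {T. norm T \<le> 1}"
  by (simp add: Theta_def weak_operator_topology_def topspace_pullback_topology)

lemma continuous_map_weak_operator_topology:
  fixes F :: "'t \<Rightarrow> 'a::real_normed_vector \<Rightarrow>\<^sub>L 'b::real_normed_vector"
  shows "continuous_map T weak_operator_topology F \<longleftrightarrow>
    (\<forall>v (f :: 'b \<Rightarrow>\<^sub>L real). continuous_map T euclidean (\<lambda>y. blinfun_apply f (blinfun_apply (F y) v)))"
    (is "?L \<longleftrightarrow> ?R")
proof
  let ?ev = "\<lambda>(T :: 'a \<Rightarrow>\<^sub>L 'b) (v, f :: 'b \<Rightarrow>\<^sub>L real). blinfun_apply f (blinfun_apply T v)"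
  { assume L: ?L
    show ?R
    proof (intro allI)
      fix v and f :: "'b \<Rightarrow>\<^sub>L real"
      have "continuous_map weak_operator_topology euclidean ((\<lambda>g. g (v, f)) \<circ> ?ev)"
        unfolding weak_operator_topology_def
        by (rule continuous_map_pullback) (simp add: continuous_on_product_coordinates)
      from continuous_map_compose[OF L this]
      show "continuous_map T euclidean (\<lambda>y. blinfun_apply f (blinfun_apply (F y) v))"
        by (simp add: o_def)
    qed }
  { assume R: ?R
    have "continuous_map T (product_topology (\<lambda>_. euclideanreal) UNIV) (?ev \<circ> F)"
      unfolding continuous_map_componentwise_UNIV using R by (auto simp: o_def)
    then have "continuous_map T euclidean (?ev \<circ> F)"
      unfolding euclidean_product_topology .
    then show ?L
      unfolding weak_operator_topology_def by (rule continuous_map_pullback') auto }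
qed

lemma continuous_map_Theta:
  fixes F :: "'t \<Rightarrow> 'a::real_normed_vector \<Rightarrow>\<^sub>L 'a"
  shows "continuous_map T Theta F \<longleftrightarrow>
    (\<forall>y\<in>topspace T. norm (F y) \<le> 1) \<and>
    (\<forall>v (f :: 'a \<Rightarrow>\<^sub>L real). continuous_map T euclidean (\<lambda>y. blinfun_apply f (blinfun_apply (F y) v)))"
  unfolding Theta_def continuous_map_in_subtopology continuous_map_weak_operator_topology
  by (simp add: image_subset_iff conj_commute Pi_iff)

lemma norm_compose_le_1:
  assumes "norm S \<le> 1" "norm T \<le> 1"
  shows "norm (S o\<^sub>L T) \<le> 1"
proof -
  have "norm (S o\<^sub>L T) \<le> norm S * norm T" by (rule norm_blinfun_compose)
  also have "\<dots> \<le> 1 * 1" by (rule mult_mono[OF assms]) auto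
  finally show ?thesis by simp
qed

lemma compact_system_Theta_op:
  "compact_system (Theta :: ('a::real_normed_vector \<Rightarrow>\<^sub>L 'a) topology) Theta_op_mult id_blinfun
     dual_ball adjoint_action"
proof -
  have ev: "continuous_map Theta euclidean (\<lambda>T :: 'a \<Rightarrow>\<^sub>L 'a. blinfun_apply f (blinfun_apply T v))"
    for v and f :: "'a \<Rightarrow>\<^sub>L real"
    using continuous_map_Theta[of Theta "\<lambda>T :: 'a \<Rightarrow>\<^sub>L 'a. T"] by simp
  have ev': "continuous_map dual_ball euclidean (\<lambda>f :: 'a \<Rightarrow>\<^sub>L real. blinfun_apply f v)" for v
    using continuous_map_dual_ball[of dual_ball "\<lambda>f :: 'a \<Rightarrow>\<^sub>L real. f"] by simp
  have "norm (id_blinfun :: 'a \<Rightarrow>\<^sub>L 'a) \<le> 1"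
    by (rule norm_blinfun_bound) auto
  moreover have "continuous_map Theta Theta (Theta_op_mult T)"
    "continuous_map Theta Theta (\<lambda>R. Theta_op_mult R T)" if "norm T \<le> 1" for T :: "'a \<Rightarrow>\<^sub>L 'a"
  proof -
    show "continuous_map Theta Theta (Theta_op_mult T)"
      unfolding continuous_map_Theta Theta_op_mult_def
      using that by (auto simp: topspace_Theta norm_compose_le_1 ev)
    have "blinfun_apply f (blinfun_apply (T o\<^sub>L R) v) = blinfun_apply (f o\<^sub>L T) (blinfun_apply R v)"
      for f :: "'a \<Rightarrow>\<^sub>L real" and R v by simp
    then show "continuous_map Theta Theta (\<lambda>R. Theta_op_mult R T)"
      unfolding continuous_map_Theta Theta_op_mult_def
      using that ev[of "_ o\<^sub>L T"] by (auto simp: topspace_Theta norm_compose_le_1)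
  qed
  ultimately have "semitopological_monoid (Theta :: ('a \<Rightarrow>\<^sub>L 'a) topology) Theta_op_mult id_blinfun"
    unfolding semitopological_monoid_def
    by (auto simp: topspace_Theta Theta_op_mult_def intro!: blinfun_eqI)
  then show ?thesis
    unfolding compact_system_def
    by (auto simp: compact_dual_ball Hausdorff_dual_ball adjoint_action_def Theta_op_mult_def
        topspace_Theta topspace_dual_ball continuous_map_dual_ball norm_compose_le_1 ev ev'
        intro!: blinfun_eqI)
qed

lemma env_semigroup_admissible:
  "compact_space (env_topology V)" "Hausdorff_space (env_topology V)"
  "admissible_semigroup (env_topology V) (compose (topspace dual_ball))"
  unfolding env_topology_def env_semigroup_def
  by (rule enveloping_semigroup_admissible[OF compact_system_Theta_op])+

end

theory Submission
  imports Defs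
begin

text \<open>
  The equivalence of tameness of the system with fragmentability of all elements of the enveloping
  semigroup holds by definition. The remaining conditions are proved in a cycle, and each step reduces to
  real-valued functions, since a map into a compact Hausdorff space is fragmented as soon as its compositions with
  a separating family of continuous functions are (\<open>fragmented_iff_separating\<close>).

  A Rosenthal space has fragmented enveloping semigroup elements (\<open>rosenthal_imp_fragmented\<close>): the function
  \<open>f \<mapsto> p f v\<close> on the dual ball is a pointwise limit of evaluations at vectors from a bounded set. If it is not
  fragmented, it oscillates across a fixed gap on every nonempty relatively open subset of some nonempty
  set, and imitating it at more and more points yields a bounded sequence of vectors on which the dual
  ball realizes every finite pattern of small and large values. Such a sequence is equivalent to the
  unit vectors of \<open>l\<^sub>1\<close>.

  Fragmentability of the elements gives fragmentability of the left translations, whose coordinates are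
  elements composed with continuous evaluations (\<open>fragmented_imp_tame_semigroup\<close>).

  A tame semigroup excludes \<open>l\<^sub>1\<close> (\<open>sign_functionals_imp_not_tame_semigroup\<close>): by Hahn-Banach a
  copy of \<open>l\<^sub>1\<close> provides vectors \<open>v\<^sub>n\<close> on which the dual ball realizes all sequences of signs. A cluster
  point of adjoints of rank one operators behaves like a limit along \<open>n\<close> of the values at \<open>v\<^sub>n\<close>, and such a
  limit is not fragmented on the Cantor set of sign sequences. A minimal closed set mapping onto the
  Cantor set (\<open>irreducible_closed_subset\<close>) lifts this to the semigroup.
\<close>

section \<open>Fragmented maps and separating families\<close>

text \<open>The usual uniformity of the reals, in the form that \<^const>\<open>fragmented\<close> expects.\<close>
abbreviation real_entourages :: "(real \<times> real) set set"
  where "real_entourages \<equiv> {E. eventually (\<lambda>z. z \<in> E) uniformity}"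

lemma fragmented_real_iff:
  "fragmented X real_entourages g \<longleftrightarrow>
    (\<forall>A \<delta>. A \<noteq> {} \<and> A \<subseteq> topspace X \<and> \<delta> > 0 \<longrightarrow>
      (\<exists>G. openin X G \<and> G \<inter> A \<noteq> {} \<and> (\<forall>x\<in>G \<inter> A. \<forall>y\<in>G \<inter> A. \<bar>g x - g y\<bar> < \<delta>)))"
  (is "?L \<longleftrightarrow> ?R")
proof
  assume L: ?L
  show ?R
  proof (intro allI impI)
    fix A and \<delta> :: real
    assume A: "A \<noteq> {} \<and> A \<subseteq> topspace X \<and> \<delta> > 0"
    then have "{(s, t). dist s t < \<delta>} \<in> real_entourages"
      by (auto simp: eventually_uniformity_metric)
    with L A obtain G where "openin X G" "G \<inter> A \<noteq> {}"
      "g ` (G \<inter> A) \<times> g ` (G \<inter> A) \<subseteq> {(s, t). dist s t < \<delta>}"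
      unfolding fragmented_def by meson
    then show "\<exists>G. openin X G \<and> G \<inter> A \<noteq> {} \<and> (\<forall>x\<in>G \<inter> A. \<forall>y\<in>G \<inter> A. \<bar>g x - g y\<bar> < \<delta>)"
      by (intro exI[of _ G]) (auto simp: dist_real_def)
  qed
next
  assume R: ?R
  show ?L
    unfolding fragmented_def
  proof (intro allI impI)
    fix A \<epsilon> assume A: "A \<noteq> {} \<and> A \<subseteq> topspace X \<and> \<epsilon> \<in> real_entourages"
    then obtain \<delta> where \<delta>: "\<delta> > 0" "\<And>s t. dist s t < \<delta> \<Longrightarrow> (s, t) \<in> \<epsilon>"
      by (auto simp: eventually_uniformity_metric)
    obtain G where "openin X G" "G \<inter> A \<noteq> {}" "\<forall>x\<in>G \<inter> A. \<forall>y\<in>G \<inter> A. \<bar>g x - g y\<bar> < \<delta>"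
      using R A \<delta>(1) by meson
    then show "\<exists>G. openin X G \<and> G \<inter> A \<noteq> {} \<and> g ` (G \<inter> A) \<times> g ` (G \<inter> A) \<subseteq> \<epsilon>"
      using \<delta>(2) by (intro exI[of _ G]) (auto simp: dist_real_def)
  qed
qed

lemma fragmented_real_finite:
  assumes "finite F" and "\<And>\<phi>. \<phi> \<in> F \<Longrightarrow> fragmented X real_entourages (\<lambda>x. \<phi> (f x))"
    and "A \<noteq> {}" "A \<subseteq> topspace X" "\<delta> > 0"
  shows "\<exists>G. openin X G \<and> G \<inter> A \<noteq> {} \<and>
    (\<forall>\<phi>\<in>F. \<forall>x\<in>G \<inter> A. \<forall>y\<in>G \<inter> A. \<bar>\<phi> (f x) - \<phi> (f y)\<bar> < \<delta>)"
  using assms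
proof (induction F)
  case empty
  then show ?case by (intro exI[of _ "topspace X"]) auto
next
  case (insert \<psi> F)
  then obtain G where G: "openin X G" "G \<inter> A \<noteq> {}"
    "\<forall>\<phi>\<in>F. \<forall>x\<in>G \<inter> A. \<forall>y\<in>G \<inter> A. \<bar>\<phi> (f x) - \<phi> (f y)\<bar> < \<delta>"
    by blast
  have "fragmented X real_entourages (\<lambda>x. \<psi> (f x))" "G \<inter> A \<subseteq> topspace X"
    using insert.prems by auto
  then obtain H where H: "openin X H" "H \<inter> (G \<inter> A) \<noteq> {}"
    "\<forall>x\<in>H \<inter> (G \<inter> A). \<forall>y\<in>H \<inter> (G \<inter> A). \<bar>\<psi> (f x) - \<psi> (f y)\<bar> < \<delta>"
    using G(2) \<open>\<delta> > 0\<close> unfolding fragmented_real_iff by meson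
  show ?case
    using G H by (intro exI[of _ "H \<inter> G"]) auto
qed

text \<open>Off the open set \<open>W\<close> any two points are separated by some \<open>\<phi>\<close>, with a gap that persists nearby;
  the complement of \<open>W\<close> is compact, so finitely many \<open>\<phi>\<close> and one gap \<open>\<delta>\<close> serve for all of it.\<close>
lemma compact_entourage_from_separating:
  assumes cpt: "compact_space Y"
    and cont: "\<And>\<phi>. \<phi> \<in> \<Phi> \<Longrightarrow> continuous_map Y euclideanreal \<phi>"
    and sep: "\<And>x y. x \<in> topspace Y \<Longrightarrow> y \<in> topspace Y \<Longrightarrow> x \<noteq> y \<Longrightarrow> \<exists>\<phi>\<in>\<Phi>. \<phi> x \<noteq> \<phi> y"
    and W: "openin (prod_topology Y Y) W" "Id_on (topspace Y) \<subseteq> W"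
  shows "\<exists>F \<delta>. finite F \<and> F \<subseteq> \<Phi> \<and> \<delta> > 0 \<and>
    (\<forall>x\<in>topspace Y. \<forall>y\<in>topspace Y. (\<forall>\<phi>\<in>F. \<bar>\<phi> x - \<phi> y\<bar> < \<delta>) \<longrightarrow> (x, y) \<in> W)"
proof -
  define C where "C = topspace Y \<times> topspace Y - W"
  have "compact_space (prod_topology Y Y)" by (simp add: compact_space_prod_topology cpt)
  moreover have "closedin (prod_topology Y Y) C"
    unfolding C_def using W(1) by (metis closedin_diff closedin_topspace topspace_prod_topology)
  ultimately have C: "compactin (prod_topology Y Y) C" by (rule closedin_compact_space)
  define U where "U = (\<lambda>(\<phi>, \<delta>::real).
    {z \<in> topspace (prod_topology Y Y). \<bar>\<phi> (fst z) - \<phi> (snd z)\<bar> \<in> {\<delta><..}})"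
  define I where "I = \<Phi> \<times> {0::real<..}"
  have U: "openin (prod_topology Y Y) (U i)" if "i \<in> I" for i
  proof -
    obtain \<phi> \<delta> where i: "i = (\<phi>, \<delta>)" "\<phi> \<in> \<Phi>" using \<open>i \<in> I\<close> by (auto simp: I_def)
    have "continuous_map (prod_topology Y Y) euclideanreal (\<lambda>z. \<bar>\<phi> (fst z) - \<phi> (snd z)\<bar>)"
      using continuous_map_compose[OF continuous_map_fst cont[OF i(2)]]
        continuous_map_compose[OF continuous_map_snd cont[OF i(2)]]
      by (intro continuous_map_real_abs continuous_map_diff) (auto simp: o_def)
    then show ?thesis
      unfolding U_def i by (simp only: prod.case) (rule openin_continuous_map_preimage, auto)
  qed
  have "C \<subseteq> \<Union>(U ` I)"
  proof
    fix z assume z: "z \<in> C"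
    obtain x y where xy: "z = (x, y)" "x \<in> topspace Y" "y \<in> topspace Y" "(x, y) \<notin> W"
      using z by (auto simp: C_def)
    then have "x \<noteq> y" using W(2) by auto
    then obtain \<phi> where "\<phi> \<in> \<Phi>" "\<phi> x \<noteq> \<phi> y" using sep xy by blast
    then show "z \<in> \<Union>(U ` I)"
      using xy by (intro UN_I[of "(\<phi>, \<bar>\<phi> x - \<phi> y\<bar> / 2)"]) (auto simp: I_def U_def)
  qed
  then obtain \<F> where "finite \<F>" "\<F> \<subseteq> U ` I" "C \<subseteq> \<Union>\<F>"
    using C U unfolding compactin_def by (metis (no_types, lifting) imageE)
  then obtain K where K: "finite K" "K \<subseteq> I" "C \<subseteq> \<Union>(U ` K)"
    by (metis finite_subset_image)
  define \<delta> where "\<delta> = Min (insert 1 (snd ` K))"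
  have "\<delta> > 0" using K by (auto simp: \<delta>_def I_def)
  moreover have \<delta>: "\<delta> \<le> snd i" if "i \<in> K" for i
    unfolding \<delta>_def using K that by (intro Min_le) auto
  have "(x, y) \<in> W" if "x \<in> topspace Y" "y \<in> topspace Y" "\<forall>\<phi>\<in>fst ` K. \<bar>\<phi> x - \<phi> y\<bar> < \<delta>" for x y
  proof (rule ccontr)
    assume "(x, y) \<notin> W"
    then have "(x, y) \<in> \<Union>(U ` K)" using K(3) that(1,2) unfolding C_def by blast
    then obtain i where i: "i \<in> K" "(x, y) \<in> U i" by blast
    then show False using that(3) \<delta>[OF i(1)] by (force simp: U_def split: prod.splits)
  qed
  ultimately show ?thesis
    using K by (intro exI[of _ "fst ` K"] exI[of _ \<delta>]) (auto simp: I_def)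
qed

text \<open>Finitely many fragmented real functions are small simultaneously on a common open set (shrink the
  set once for each), and by the previous lemma finitely many separating functions control an
  entourage. This reduces fragmentability into the dual ball, and into the enveloping semigroup, to
  fragmentability of real-valued functions.\<close>
lemma fragmented_iff_separating:
  assumes Y: "compact_space Y" "Hausdorff_space Y"
    and f: "f \<in> topspace X \<rightarrow> topspace Y"
    and cont: "\<And>\<phi>. \<phi> \<in> \<Phi> \<Longrightarrow> continuous_map Y euclideanreal \<phi>"
    and sep: "\<And>x y. x \<in> topspace Y \<Longrightarrow> y \<in> topspace Y \<Longrightarrow> x \<noteq> y \<Longrightarrow> \<exists>\<phi>\<in>\<Phi>. \<phi> x \<noteq> \<phi> y"
  shows "fragmented X (compact_uniformity Y) f \<longleftrightarrow>
    (\<forall>\<phi>\<in>\<Phi>. fragmented X real_entourages (\<lambda>x. \<phi> (f x)))" (is "?L \<longleftrightarrow> ?R")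
proof
  assume L: ?L
  show ?R
    unfolding fragmented_real_iff
  proof (intro ballI allI impI)
    fix \<phi> A and \<delta> :: real
    assume \<phi>: "\<phi> \<in> \<Phi>" and A: "A \<noteq> {} \<and> A \<subseteq> topspace X \<and> \<delta> > 0"
    define W where "W = {z \<in> topspace (prod_topology Y Y). \<bar>\<phi> (fst z) - \<phi> (snd z)\<bar> \<in> {..<\<delta>}}"
    have "continuous_map (prod_topology Y Y) euclideanreal (\<lambda>z. \<bar>\<phi> (fst z) - \<phi> (snd z)\<bar>)"
      using continuous_map_compose[OF continuous_map_fst cont[OF \<phi>]]
        continuous_map_compose[OF continuous_map_snd cont[OF \<phi>]]
      by (intro continuous_map_real_abs continuous_map_diff) (auto simp: o_def)
    then have "openin (prod_topology Y Y) W"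
      unfolding W_def by (rule openin_continuous_map_preimage) auto
    moreover have "Id_on (topspace Y) \<subseteq> W" using A by (auto simp: W_def)
    ultimately have "W \<in> compact_uniformity Y"
      unfolding compact_uniformity_eq[OF Y] by (auto simp: W_def)
    then obtain G where "openin X G" "G \<inter> A \<noteq> {}" "f ` (G \<inter> A) \<times> f ` (G \<inter> A) \<subseteq> W"
      using L A unfolding fragmented_def by meson
    moreover from this(3) have "(f x, f y) \<in> W" if "x \<in> G \<inter> A" "y \<in> G \<inter> A" for x y
      using that by blast
    ultimately show "\<exists>G. openin X G \<and> G \<inter> A \<noteq> {} \<and>
        (\<forall>x\<in>G \<inter> A. \<forall>y\<in>G \<inter> A. \<bar>\<phi> (f x) - \<phi> (f y)\<bar> < \<delta>)"
      unfolding W_def by (intro exI[of _ G]) force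
  qed
next
  assume R: ?R
  show ?L
    unfolding fragmented_def
  proof (intro allI impI)
    fix A \<epsilon> assume A: "A \<noteq> {} \<and> A \<subseteq> topspace X \<and> \<epsilon> \<in> compact_uniformity Y"
    then obtain W where W: "openin (prod_topology Y Y) W" "Id_on (topspace Y) \<subseteq> W" "W \<subseteq> \<epsilon>"
      unfolding compact_uniformity_eq[OF Y] by blast
    obtain F \<delta> where F: "finite F" "F \<subseteq> \<Phi>" "\<delta> > 0"
      "\<forall>x\<in>topspace Y. \<forall>y\<in>topspace Y. (\<forall>\<phi>\<in>F. \<bar>\<phi> x - \<phi> y\<bar> < \<delta>) \<longrightarrow> (x, y) \<in> W"
      using compact_entourage_from_separating[OF Y(1) _ _ W(1,2), where \<Phi> = \<Phi>] cont sep by blast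
    obtain G where G: "openin X G" "G \<inter> A \<noteq> {}"
      "\<forall>\<phi>\<in>F. \<forall>x\<in>G \<inter> A. \<forall>y\<in>G \<inter> A. \<bar>\<phi> (f x) - \<phi> (f y)\<bar> < \<delta>"
      using fragmented_real_finite[OF F(1), of X f A \<delta>] R F(2,3) A by blast
    have "f ` (G \<inter> A) \<subseteq> topspace Y" using f A by auto
    then have "f ` (G \<inter> A) \<times> f ` (G \<inter> A) \<subseteq> \<epsilon>" using F(4) G(3) W(3) by blast
    then show "\<exists>G. openin X G \<and> G \<inter> A \<noteq> {} \<and> f ` (G \<inter> A) \<times> f ` (G \<inter> A) \<subseteq> \<epsilon>"
      using G by blast
  qed
qed

lemma fragmented_compose_continuous:
  assumes q: "continuous_map X Y q" and f: "fragmented Y \<U> f"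
  shows "fragmented X \<U> (\<lambda>x. f (q x))"
  unfolding fragmented_def
proof (intro allI impI)
  fix A \<epsilon> assume A: "A \<noteq> {} \<and> A \<subseteq> topspace X \<and> \<epsilon> \<in> \<U>"
  have "q ` A \<noteq> {}" "q ` A \<subseteq> topspace Y"
    using A continuous_map_image_subset_topspace[OF q] by auto
  then obtain G where G: "openin Y G" "G \<inter> q ` A \<noteq> {}" "f ` (G \<inter> q ` A) \<times> f ` (G \<inter> q ` A) \<subseteq> \<epsilon>"
    using f A unfolding fragmented_def by meson
  have "openin X {x \<in> topspace X. q x \<in> G}" by (rule openin_continuous_map_preimage[OF q G(1)])
  then show "\<exists>H. openin X H \<and> H \<inter> A \<noteq> {} \<and>
      (\<lambda>x. f (q x)) ` (H \<inter> A) \<times> (\<lambda>x. f (q x)) ` (H \<inter> A) \<subseteq> \<epsilon>"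
    using G(2,3) A by (intro exI[of _ "{x \<in> topspace X. q x \<in> G}"]) fast
qed


section \<open>Extension of functionals\<close>

definition sublinear :: "('a::real_vector \<Rightarrow> real) \<Rightarrow> bool"
  where "sublinear p \<longleftrightarrow> (\<forall>x y. p (x + y) \<le> p x + p y) \<and> (\<forall>c x. c > 0 \<longrightarrow> p (c *\<^sub>R x) = c * p x)"

lemma sublinearI:
  assumes add: "\<And>x y. p (x + y) \<le> p x + p y"
    and le: "\<And>c x. c > 0 \<Longrightarrow> p (c *\<^sub>R x) \<le> c * p x"
  shows "sublinear p"
proof -
  have "c * p x \<le> p (c *\<^sub>R x)" if "c > 0" for c x
    using le[of "inverse c" "c *\<^sub>R x"] that by (simp add: field_simps)
  then show ?thesis
    using add le unfolding sublinear_def by (simp add: order_antisym)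
qed

lemma sublinear_zero: "sublinear p \<Longrightarrow> p 0 = 0"
  unfolding sublinear_def
  by (metis mult_2 real_vector.scale_zero_right add_cancel_right_right zero_less_numeral)

lemma sublinear_minus_le: "sublinear p \<Longrightarrow> - p (- x) \<le> p x"
  using sublinear_zero[of p] unfolding sublinear_def
  by (metis add.right_inverse minus_le_iff add_le_same_cancel1 add.inverse_inverse
      diff_ge_0_iff_ge diff_minus_eq_add add.commute)

text \<open>For fixed \<open>y\<close>, the infimum of \<open>p (x + t y) - t p y\<close> over \<open>t \<ge> 0\<close> is again sublinear in \<open>x\<close> and below
  \<open>p\<close>, hence equal to \<open>p\<close>. Taking \<open>t = 1\<close> gives the reverse of subadditivity.\<close>
lemma sublinear_minimal_linear:
  assumes p: "sublinear p" and min: "\<And>q. sublinear q \<Longrightarrow> q \<le> p \<Longrightarrow> q = p"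
  shows "linear p"
proof -
  have padd: "p (x + y) \<le> p x + p y" and psc: "c > 0 \<Longrightarrow> p (c *\<^sub>R x) = c * p x" for x y c
    using p by (auto simp: sublinear_def)
  have super: "p x + p y \<le> p (x + y)" for x y
  proof -
    define q where "q x = (INF t\<in>{0..}. p (x + t *\<^sub>R y) - t * p y)" for x
    have bdd: "bdd_below ((\<lambda>t. p (x + t *\<^sub>R y) - t * p y) ` {0..})" for x
    proof (rule bdd_belowI2)
      fix t :: real assume "t \<in> {0..}"
      then have t: "p (t *\<^sub>R y) = t * p y"
        using psc[of t y] sublinear_zero[OF p] by (cases "t = 0") auto
      have "p (t *\<^sub>R y) \<le> p (x + t *\<^sub>R y) + p (- x)"
        using padd[of "x + t *\<^sub>R y" "- x"] by simp
      then show "- p (- x) \<le> p (x + t *\<^sub>R y) - t * p y" using t by simp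
    qed
    have q_le: "q x \<le> p (x + t *\<^sub>R y) - t * p y" if "t \<ge> 0" for x t
      unfolding q_def using that by (intro cINF_lower bdd) auto
    have q_ge: "z \<le> q x" if "\<And>t. t \<ge> 0 \<Longrightarrow> z \<le> p (x + t *\<^sub>R y) - t * p y" for x z
      unfolding q_def using that by (intro cINF_greatest) auto
    have "sublinear q"
    proof (rule sublinearI)
      fix u v
      have "q (u + v) - (p (u + s *\<^sub>R y) - s * p y) \<le> p (v + t *\<^sub>R y) - t * p y"
        if "s \<ge> 0" "t \<ge> 0" for s t
        using q_le[of "s + t" "u + v"] padd[of "u + s *\<^sub>R y" "v + t *\<^sub>R y"] that
        by (simp add: algebra_simps)
      then have "q (u + v) - (p (u + s *\<^sub>R y) - s * p y) \<le> q v" if "s \<ge> 0" for s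
        using that by (intro q_ge)
      then have "q (u + v) - q v \<le> q u"
        by (intro q_ge) (simp add: algebra_simps)
      then show "q (u + v) \<le> q u + q v" by simp
    next
      fix c :: real and u assume c: "c > 0"
      have "inverse c * q (c *\<^sub>R u) \<le> q u"
      proof (rule q_ge)
        fix t :: real assume t: "t \<ge> 0"
        have "q (c *\<^sub>R u) \<le> c * (p (u + t *\<^sub>R y) - t * p y)"
          using q_le[of "c * t" "c *\<^sub>R u"] psc[OF c, of "u + t *\<^sub>R y"] c t
          by (simp add: algebra_simps)
        then show "inverse c * q (c *\<^sub>R u) \<le> p (u + t *\<^sub>R y) - t * p y"
          using c by (simp add: field_simps)
      qed
      then show "q (c *\<^sub>R u) \<le> c * q u" using c by (simp add: field_simps)
    qed
    moreover have "q \<le> p" using q_le[of 0] by (auto simp: le_fun_def)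
    ultimately have "q = p" by (rule min)
    then show ?thesis using q_le[of 1 x] by simp
  qed
  have add: "p (x + y) = p x + p y" for x y
    using super padd by (simp add: order_antisym)
  have minus: "p (- x) = - p x" for x
    using add[of x "- x"] sublinear_zero[OF p] by simp
  show ?thesis
  proof (rule linearI)
    fix c :: real and x
    consider "c > 0" | "c = 0" | "- c > 0" by linarith
    then show "p (c *\<^sub>R x) = c *\<^sub>R p x"
      using psc[of c x] psc[of "- c" x] minus[of "c *\<^sub>R x"] sublinear_zero[OF p]
      by cases auto
  qed (rule add)
qed

text \<open>The Hahn-Banach theorem: a minimal sublinear functional below \<open>p\<close>, found with Zorn's lemma, is
  linear. Infima of chains exist because \<open>q x \<ge> - q (- x) \<ge> - p (- x)\<close> for every sublinear \<open>q \<le> p\<close>.\<close>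
lemma linear_below_sublinear:
  assumes p: "sublinear p"
  shows "\<exists>f. linear f \<and> (\<forall>x. f x \<le> p x)"
proof -
  define A where "A = {q. sublinear q \<and> q \<le> p}"
  have "\<exists>m\<in>A. \<forall>q\<in>A. q \<le> m \<longrightarrow> q = m"
  proof (rule predicate_Zorn)
    show "partial_order_on A (relation_of (\<lambda>r q. q \<le> r) A)"
      by (rule partial_order_on_relation_ofI) auto
    fix C assume C: "C \<in> Chains (relation_of (\<lambda>r q. q \<le> r) A)"
    then have CA: "q \<in> A" if "q \<in> C" for q
      using that by (auto simp: Chains_def relation_of_def)
    have chain: "q \<le> r \<or> r \<le> q" if "q \<in> C" "r \<in> C" for q r
      using C that by (auto simp: Chains_def relation_of_def)
    show "\<exists>u\<in>A. \<forall>q\<in>C. u \<le> q"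
    proof (cases "C = {}")
      case True
      then show ?thesis using p by (auto simp: A_def)
    next
      case False
      define u where "u x = (INF q\<in>C. q x)" for x
      have bdd: "bdd_below ((\<lambda>q. q x) ` C)" for x
      proof (rule bdd_belowI2)
        fix q assume "q \<in> C"
        then have "sublinear q" "q \<le> p" using CA by (auto simp: A_def)
        then show "- p (- x) \<le> q x"
          using sublinear_minus_le[of q x] le_funD[of q p "- x"] by linarith
      qed
      have u_le: "u x \<le> q x" if "q \<in> C" for q x
        unfolding u_def using that by (intro cINF_lower bdd)
      have u_ge: "z \<le> u x" if "\<And>q. q \<in> C \<Longrightarrow> z \<le> q x" for z x
        unfolding u_def using that False by (intro cINF_greatest)
      have "sublinear u"
      proof (rule sublinearI)
        fix x y
        have "u (x + y) - q x \<le> r y" if q: "q \<in> C" and r: "r \<in> C" for q r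
        proof -
          have "sublinear q" "sublinear r" using CA q r by (auto simp: A_def)
          then have "q (x + y) \<le> q x + q y" "r (x + y) \<le> r x + r y" by (auto simp: sublinear_def)
          then show ?thesis
            using chain[OF q r] u_le[OF q, of "x + y"] u_le[OF r, of "x + y"]
            by (smt (verit) le_funD)
        qed
        then have "u (x + y) - q x \<le> u y" if "q \<in> C" for q
          using that by (intro u_ge)
        then have "u (x + y) - u y \<le> u x" by (intro u_ge) (simp add: algebra_simps)
        then show "u (x + y) \<le> u x + u y" by simp
      next
        fix c :: real and x assume c: "c > 0"
        have "inverse c * u (c *\<^sub>R x) \<le> u x"
        proof (rule u_ge)
          fix q assume q: "q \<in> C"
          then have "q (c *\<^sub>R x) = c * q x" using CA c by (auto simp: A_def sublinear_def)
          then show "inverse c * u (c *\<^sub>R x) \<le> q x"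
            using u_le[OF q, of "c *\<^sub>R x"] c by (simp add: field_simps)
        qed
        then show "u (c *\<^sub>R x) \<le> c * u x" using c by (simp add: field_simps)
      qed
      moreover have "u \<le> p"
      proof -
        obtain q where q: "q \<in> C" using False by blast
        then show ?thesis using u_le[OF q] CA[OF q] by (auto simp: A_def le_fun_def intro: order_trans)
      qed
      ultimately show ?thesis using u_le by (intro bexI[of _ u]) (auto simp: A_def le_fun_def)
    qed
  qed
  then obtain m where m: "m \<in> A" "\<And>q. q \<in> A \<Longrightarrow> q \<le> m \<Longrightarrow> q = m" by blast
  have "linear m"
  proof (rule sublinear_minimal_linear)
    show "sublinear m" using m by (auto simp: A_def)
    fix q assume q: "sublinear q" "q \<le> m"
    moreover have "m \<le> p" using m by (auto simp: A_def)
    ultimately have "q \<in> A" unfolding A_def using order_trans[of q m p] by blast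
    then show "q = m" using m(2) q by blast
  qed
  then show ?thesis using m by (auto simp: A_def le_fun_def)
qed

text \<open>The Hahn-Banach theorem for a bounded functional on the range of \<open>J\<close>, pulled back along \<open>J\<close>. A linear
  functional below \<open>p x = inf\<^sub>y (C \<parallel>x - J y\<parallel> + \<psi> y)\<close> has norm at most \<open>C\<close> (take \<open>y = 0\<close>) and is at most
  \<open>\<psi> y\<close> at \<open>J y\<close>; applying the latter to \<open>- y\<close> gives equality.\<close>
lemma functional_extension:
  fixes J :: "'b::real_vector \<Rightarrow> 'a::real_normed_vector" and \<psi> :: "'b \<Rightarrow> real"
  assumes J: "linear J" and \<psi>: "linear \<psi>" and C: "\<And>y. \<psi> y \<le> C * norm (J y)" "C \<ge> 0"
  shows "\<exists>f :: 'a \<Rightarrow>\<^sub>L real. norm f \<le> C \<and> (\<forall>y. blinfun_apply f (J y) = \<psi> y)"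
proof -
  interpret J: linear J by fact
  interpret \<psi>: linear \<psi> by fact
  define p where "p x = (INF y. C * norm (x - J y) + \<psi> y)" for x
  have bdd: "bdd_below (range (\<lambda>y. C * norm (x - J y) + \<psi> y))" for x
  proof (rule bdd_belowI2)
    fix y
    have "norm (J (- y)) \<le> norm (x - J y) + norm x"
      using norm_triangle_ineq4[of "x - J y" x] by (simp add: J.neg)
    then have "\<psi> (- y) \<le> C * (norm (x - J y) + norm x)"
      using C(1)[of "- y"] mult_left_mono[OF _ C(2)] by (meson order_trans)
    then show "- C * norm x \<le> C * norm (x - J y) + \<psi> y"
      by (simp add: \<psi>.neg algebra_simps)
  qed
  have p_le: "p x \<le> C * norm (x - J y) + \<psi> y" for x y
    unfolding p_def by (intro cINF_lower bdd) auto
  have p_ge: "z \<le> p x" if "\<And>y. z \<le> C * norm (x - J y) + \<psi> y" for z x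
    unfolding p_def using that by (intro cINF_greatest) auto
  have "sublinear p"
  proof (rule sublinearI)
    fix u v
    have "p (u + v) - (C * norm (u - J y) + \<psi> y) \<le> C * norm (v - J z) + \<psi> z" for y z
    proof -
      have "norm (u + v - J (y + z)) \<le> norm (u - J y) + norm (v - J z)"
        using norm_triangle_ineq[of "u - J y" "v - J z"] by (simp add: J.add algebra_simps)
      then have "C * norm (u + v - J (y + z)) \<le> C * norm (u - J y) + C * norm (v - J z)"
        using mult_left_mono[OF _ C(2)] by (metis distrib_left)
      then show ?thesis using p_le[of "u + v" "y + z"] by (simp add: \<psi>.add)
    qed
    then have "p (u + v) - (C * norm (u - J y) + \<psi> y) \<le> p v" for y
      by (rule p_ge)
    then have "p (u + v) - p v \<le> p u" by (intro p_ge) (simp add: algebra_simps)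
    then show "p (u + v) \<le> p u + p v" by simp
  next
    fix c :: real and u assume c: "c > 0"
    have "inverse c * p (c *\<^sub>R u) \<le> p u"
    proof (rule p_ge)
      fix y
      have "norm (c *\<^sub>R u - J (c *\<^sub>R y)) = c * norm (u - J y)"
        using c by (simp add: J.scale flip: scaleR_diff_right)
      then have "p (c *\<^sub>R u) \<le> c * (C * norm (u - J y) + \<psi> y)"
        using p_le[of "c *\<^sub>R u" "c *\<^sub>R y"] by (simp add: \<psi>.scale algebra_simps)
      then show "inverse c * p (c *\<^sub>R u) \<le> C * norm (u - J y) + \<psi> y"
        using c by (simp add: field_simps)
    qed
    then show "p (c *\<^sub>R u) \<le> c * p u" using c by (simp add: field_simps)
  qed
  then obtain f where f: "linear f" "\<And>x. f x \<le> p x" using linear_below_sublinear by blast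
  interpret f: linear f by fact
  have fn: "\<bar>f x\<bar> \<le> C * norm x" for x
    using order_trans[OF f(2)[of x] p_le[of x 0]] order_trans[OF f(2)[of "- x"] p_le[of "- x" 0]]
    by (auto simp: J.zero \<psi>.zero f.neg)
  have fJ: "f (J y) = \<psi> y" for y
    using order_trans[OF f(2)[of "J y"] p_le[of "J y" y]]
      order_trans[OF f(2)[of "J (- y)"] p_le[of "J (- y)" "- y"]]
    by (simp add: J.neg f.neg \<psi>.neg)
  have bl: "bounded_linear f"
    using fn by (intro bounded_linear_intro[of _ C]) (auto simp: f.add f.scale mult.commute)
  show ?thesis
    using fn fJ C(2)
    by (intro exI[of _ "Blinfun f"] conjI norm_blinfun_bound) (auto simp: bounded_linear_Blinfun_apply bl)
qed
section \<open>Copies of l1 and patterns of functionals\<close>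

lift_definition l1_unit :: "nat \<Rightarrow> l1" is "\<lambda>n k. if k = n then 1 else 0"
  by (rule summable_finite[of "{_}"]) auto

lemma norm_l1_unit: "norm (l1_unit n) = 1"
proof -
  have "(\<Sum>k. \<bar>if k = n then 1 else 0 :: real\<bar>) = (\<Sum>k\<in>{n}. \<bar>if k = n then 1 else 0 :: real\<bar>)"
    by (rule suminf_finite) auto
  then show ?thesis by (simp add: norm_l1.rep_eq l1_unit.rep_eq)
qed

lemma linear_norm_bound:
  fixes J :: "'b::real_normed_vector \<Rightarrow> 'c::real_normed_vector"
  assumes J: "linear J" and \<delta>: "\<And>y. norm y < \<delta> \<Longrightarrow> norm (J y) < 1"
  shows "\<delta> * norm (J y) \<le> norm y"
proof (rule ccontr)
  assume "\<not> ?thesis"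
  then have lt: "norm y < \<delta> * norm (J y)" by simp
  then have "norm (J y) \<noteq> 0" using norm_ge_zero[of y] by (metis leD mult_zero_right)
  then have pos: "norm (J y) > 0" by simp
  have "norm ((1 / norm (J y)) *\<^sub>R y) < \<delta>" using lt pos by (simp add: field_simps)
  then have "norm (J ((1 / norm (J y)) *\<^sub>R y)) < 1" by (rule \<delta>)
  then show False using pos by (simp add: linear_cmul[OF J])
qed

lemma l1_norm_weighted_sum:
  assumes "\<And>n. \<bar>s n\<bar> \<le> 1"
  shows "summable (\<lambda>n. s n * l1_nth y n)" "(\<Sum>n. s n * l1_nth y n) \<le> norm y"
proof -
  have le: "norm (s n * l1_nth y n) \<le> \<bar>l1_nth y n\<bar>" for n
    using mult_right_mono[OF assms abs_ge_zero, of n "l1_nth y n"] by (simp add: abs_mult)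
  show *: "summable (\<lambda>n. s n * l1_nth y n)"
    by (rule summable_comparison_test'[OF summable_l1_nth[of y], of 0]) (use le in auto)
  show "(\<Sum>n. s n * l1_nth y n) \<le> norm y"
    unfolding norm_l1.rep_eq using le
    by (intro suminf_le * summable_l1_nth) (auto intro: order_trans[OF abs_ge_self])
qed

text \<open>Every sequence of signs is a functional of norm one on \<open>l\<^sub>1\<close>. Transported along an isomorphic
  embedding and extended by Hahn-Banach, it is realized on the rescaled images of the unit vectors by a
  functional in the dual ball.\<close>
lemma contains_l1_imp_sign_functionals:
  assumes "contains_l1 TYPE('a::real_normed_vector)"
  shows "\<exists>(v :: nat \<Rightarrow> 'a) c. c > 0 \<and> (\<forall>n. norm (v n) \<le> 1) \<and>
    (\<forall>S. \<exists>f :: 'a \<Rightarrow>\<^sub>L real. norm f \<le> 1 \<and> (\<forall>n. blinfun_apply f (v n) = (if n \<in> S then c else - c)))"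
proof -
  obtain J :: "l1 \<Rightarrow> 'a" and K where J: "linear J" and hom: "homeomorphism UNIV (range J) J K"
    using assms unfolding contains_l1_def by blast
  have KJ: "K (J y) = y" for y using hom by (simp add: homeomorphism_def)
  have J0: "J 0 = 0" and K0: "K 0 = 0" using linear_0[OF J] KJ[of 0] by auto
  have "continuous_on UNIV J" using hom by (simp add: homeomorphism_def)
  then obtain \<rho> where \<rho>: "\<rho> > 0" "\<And>y. norm y < \<rho> \<Longrightarrow> norm (J y) < 1"
    unfolding continuous_on_iff by (metis J0 UNIV_I diff_zero dist_norm zero_less_one)
  have J_le: "\<rho> * norm (J y) \<le> norm y" for y by (rule linear_norm_bound[OF J \<rho>(2)])
  have "continuous_on (range J) K" using hom by (simp add: homeomorphism_def)
  then obtain \<sigma> where \<sigma>: "\<sigma> > 0" "\<And>y. norm (J y) < \<sigma> \<Longrightarrow> norm y < 1"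
    unfolding continuous_on_iff by (metis J0 K0 KJ diff_zero dist_norm rangeI zero_less_one)
  have J_ge: "\<sigma> * norm y \<le> norm (J y)" for y
  proof (rule ccontr)
    assume "\<not> ?thesis"
    then have lt: "norm (J y) < \<sigma> * norm y" by simp
    then have "norm y \<noteq> 0" using norm_ge_zero[of "J y"] by (metis leD mult_zero_right)
    then have pos: "norm y > 0" by simp
    have "norm (J ((1 / norm y) *\<^sub>R y)) < \<sigma>" using lt pos by (simp add: linear_cmul[OF J] field_simps)
    then have "norm ((1 / norm y) *\<^sub>R y) < 1" by (rule \<sigma>(2))
    then show False using pos by simp
  qed
  \<comment> \<open>The factor \<open>\<rho>\<close> brings the images of the unit vectors into the unit ball.\<close>
  define v where "v n = \<rho> *\<^sub>R J (l1_unit n)" for n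
  have "\<exists>f :: 'a \<Rightarrow>\<^sub>L real. norm f \<le> 1 \<and>
      (\<forall>n. blinfun_apply f (v n) = (if n \<in> S then \<rho> * \<sigma> else - (\<rho> * \<sigma>)))" for S
  proof -
    define s :: "nat \<Rightarrow> real" where "s n = (if n \<in> S then 1 else - 1)" for n
    define \<psi> where "\<psi> y = (\<Sum>n. s n * l1_nth y n)" for y
    have s: "\<bar>s n\<bar> \<le> 1" for n by (simp add: s_def)
    have "linear \<psi>"
      by (rule linearI)
        (simp_all add: \<psi>_def plus_l1.rep_eq scaleR_l1.rep_eq distrib_left mult.left_commute
          suminf_add suminf_mult l1_norm_weighted_sum[OF s])
    moreover have "\<psi> y \<le> inverse \<sigma> * norm (J y)" for y
    proof -
      have "\<psi> y \<le> norm y" unfolding \<psi>_def by (rule l1_norm_weighted_sum(2)[OF s])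
      also have "\<dots> \<le> inverse \<sigma> * norm (J y)" using J_ge[of y] \<sigma>(1) by (simp add: field_simps)
      finally show ?thesis .
    qed
    ultimately obtain f :: "'a \<Rightarrow>\<^sub>L real" where f: "norm f \<le> inverse \<sigma>" "\<And>y. blinfun_apply f (J y) = \<psi> y"
      using functional_extension[OF J, of \<psi> "inverse \<sigma>"] \<sigma>(1) by auto
    have "\<psi> (l1_unit n) = s n" for n
    proof -
      have "(\<Sum>k. s k * l1_nth (l1_unit n) k) = (\<Sum>k\<in>{n}. s k * l1_nth (l1_unit n) k)"
        by (rule suminf_finite) (auto simp: l1_unit.rep_eq)
      then show ?thesis by (simp add: \<psi>_def l1_unit.rep_eq)
    qed
    then show ?thesis
      using f \<sigma>(1)
      by (intro exI[of _ "\<sigma> *\<^sub>R f"]) (auto simp: v_def s_def blinfun.scaleR_left blinfun.scaleR_right field_simps)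
  qed
  moreover have "norm (v n) \<le> 1" for n
    using J_le[of "l1_unit n"] \<rho>(1) by (simp add: v_def norm_l1_unit)
  ultimately show ?thesis using \<rho>(1) \<sigma>(1) by (intro exI[of _ v] exI[of _ "\<rho> * \<sigma>"]) auto
qed

text \<open>Choose \<open>f\<close> and \<open>g\<close> in the dual ball, where \<open>f\<close> is large and \<open>g\<close> is small on the \<open>w\<^sub>i\<close> with nonnegative
  coefficient and vice versa on the others. Every term of \<open>(f - g) (\<Sum> x\<^sub>i w\<^sub>i)\<close> is then at least
  \<open>(b - a) \<bar>x\<^sub>i\<bar>\<close>, while \<open>f - g\<close> has norm at most 2.\<close>
lemma independent_functionals_l1_estimate:
  fixes w :: "nat \<Rightarrow> 'a::real_normed_vector"
  assumes ind: "\<And>n S. \<exists>f :: 'a \<Rightarrow>\<^sub>L real. norm f \<le> 1 \<and>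
      (\<forall>i<n. if i \<in> S then blinfun_apply f (w i) < a else blinfun_apply f (w i) > b)"
  shows "(b - a) * (\<Sum>i<n. \<bar>x i\<bar>) \<le> 2 * norm (\<Sum>i<n. x i *\<^sub>R w i)"
proof -
  let ?u = "\<Sum>i<n. x i *\<^sub>R w i"
  obtain f :: "'a \<Rightarrow>\<^sub>L real" where f: "norm f \<le> 1"
    "\<forall>i<n. if i \<in> {i. x i < 0} then blinfun_apply f (w i) < a else blinfun_apply f (w i) > b"
    using ind by blast
  obtain g :: "'a \<Rightarrow>\<^sub>L real" where g: "norm g \<le> 1"
    "\<forall>i<n. if i \<in> {i. x i \<ge> 0} then blinfun_apply g (w i) < a else blinfun_apply g (w i) > b"
    using ind by blast
  have "(b - a) * \<bar>x i\<bar> \<le> x i * (blinfun_apply f (w i) - blinfun_apply g (w i))" if "i < n" for i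
  proof (cases "x i < 0")
    case True
    then have "b - a \<le> blinfun_apply g (w i) - blinfun_apply f (w i)"
      using f(2) g(2) \<open>i < n\<close> by force
    from mult_right_mono[OF this, of "- x i"] True show ?thesis by (simp add: algebra_simps)
  next
    case False
    then have "b - a \<le> blinfun_apply f (w i) - blinfun_apply g (w i)"
      using f(2) g(2) \<open>i < n\<close> by force
    from mult_right_mono[OF this, of "x i"] False show ?thesis by (simp add: algebra_simps)
  qed
  then have "(b - a) * (\<Sum>i<n. \<bar>x i\<bar>) \<le> (\<Sum>i<n. x i * (blinfun_apply f (w i) - blinfun_apply g (w i)))"
    unfolding sum_distrib_left by (intro sum_mono) auto
  also have "\<dots> = blinfun_apply f ?u - blinfun_apply g ?u"
    by (simp add: blinfun.sum_right blinfun.scaleR_right right_diff_distrib sum_subtractf)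
  also have "\<dots> \<le> norm (blinfun_apply f ?u) + norm (blinfun_apply g ?u)" by simp
  also have "\<dots> \<le> 2 * norm ?u"
    using norm_blinfun[of f ?u] norm_blinfun[of g ?u]
      mult_right_mono[OF f(1) norm_ge_zero[of ?u]] mult_right_mono[OF g(1) norm_ge_zero[of ?u]]
    by linarith
  finally show ?thesis .
qed

text \<open>The estimate says that \<open>x \<mapsto> \<Sum> x\<^sub>i w\<^sub>i\<close> is bounded below on \<open>l\<^sub>1\<close>. The series converges because the
  space is complete.\<close>
lemma independent_functionals_imp_contains_l1:
  fixes w :: "nat \<Rightarrow> 'a::banach"
  assumes w: "\<And>n. norm (w n) \<le> R" and ab: "a < b"
    and ind: "\<And>n S. \<exists>f :: 'a \<Rightarrow>\<^sub>L real. norm f \<le> 1 \<and>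
      (\<forall>i<n. if i \<in> S then blinfun_apply f (w i) < a else blinfun_apply f (w i) > b)"
  shows "contains_l1 TYPE('a)"
proof -
  define J :: "l1 \<Rightarrow> 'a" where "J x = (\<Sum>k. l1_nth x k *\<^sub>R w k)" for x
  have nle: "norm (l1_nth x k *\<^sub>R w k) \<le> R * \<bar>l1_nth x k\<bar>" for x k
    using mult_left_mono[OF w abs_ge_zero[of "l1_nth x k"], of k] by (simp add: mult.commute)
  have sR: "summable (\<lambda>k. R * \<bar>l1_nth x k\<bar>)" for x
    by (intro summable_mult summable_l1_nth)
  have sn: "summable (\<lambda>k. norm (l1_nth x k *\<^sub>R w k))" for x
    by (rule summable_comparison_test'[OF sR[of x], of 0]) (simp only: real_norm_def abs_norm_cancel nle)
  have sm: "summable (\<lambda>k. l1_nth x k *\<^sub>R w k)" for x by (rule summable_norm_cancel[OF sn])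
  have J_le: "norm (J x) \<le> R * norm x" for x
  proof -
    have "norm (J x) \<le> (\<Sum>k. norm (l1_nth x k *\<^sub>R w k))" unfolding J_def by (rule summable_norm[OF sn])
    also have "\<dots> \<le> (\<Sum>k. R * \<bar>l1_nth x k\<bar>)" by (intro suminf_le sn sR nle)
    also have "\<dots> = R * norm x" by (simp add: norm_l1.rep_eq suminf_mult summable_l1_nth)
    finally show ?thesis .
  qed
  have J: "linear J"
    by (rule linearI)
      (simp_all add: J_def plus_l1.rep_eq scaleR_l1.rep_eq scaleR_add_left suminf_add[OF sm sm]
        suminf_scaleR_right[OF sm])
  have J_ge: "(b - a) * norm x \<le> 2 * norm (J x)" for x
  proof (rule LIMSEQ_le)
    show "(\<lambda>n. (b - a) * (\<Sum>k<n. \<bar>l1_nth x k\<bar>)) \<longlonglongrightarrow> (b - a) * norm x"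
      unfolding norm_l1.rep_eq by (intro tendsto_intros summable_LIMSEQ summable_l1_nth)
    show "(\<lambda>n. 2 * norm (\<Sum>k<n. l1_nth x k *\<^sub>R w k)) \<longlonglongrightarrow> 2 * norm (J x)"
      unfolding J_def by (intro tendsto_intros summable_LIMSEQ sm)
  qed (use independent_functionals_l1_estimate[OF ind] in blast)
  have "norm x = 0" if "J x = 0" for x
    using J_ge[of x] that ab by (metis diff_gt_0_iff_gt le_less_trans less_irrefl mult_zero_right norm_zero
        mult_le_0_iff norm_le_zero_iff not_less zero_less_norm_iff)
  then have inj: "inj J" by (simp add: linear_injective_0[OF J])
  have "continuous_on UNIV J"
    using J_le J by (intro linear_continuous_on bounded_linear_intro[of _ R])
      (auto simp: linear_add linear_cmul mult.commute)
  moreover have "continuous_on (range J) (inv J)"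
  proof (rule lipschitz_on_continuous_on[of "2 / (b - a)"], rule lipschitz_onI)
    fix u v assume "u \<in> range J" "v \<in> range J"
    then obtain x y where "u = J x" "v = J y" by blast
    then show "dist (inv J u) (inv J v) \<le> 2 / (b - a) * dist u v"
      using J_ge[of "x - y"] ab by (simp add: inj dist_norm linear_diff[OF J] field_simps)
  qed (use ab in simp)
  ultimately have "homeomorphism UNIV (range J) J (inv J)"
    using inj by (intro homeomorphismI) auto
  then show ?thesis unfolding contains_l1_def using J by blast
qed


section \<open>Pointwise limits that are not fragmented\<close>

text \<open>Shrink the open set once for each gap \<open>(lo i, hi i)\<close> that fails to be straddled on some smaller open set.
  Either the process stops at a gap that is straddled on all smaller open sets, or no gap is
  straddled any more.\<close>
lemma straddling_open_set:
  fixes \<phi> :: "'x \<Rightarrow> real" and lo hi :: "'i \<Rightarrow> real"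
  assumes "finite I" and A: "A \<noteq> {}" "A \<subseteq> topspace X"
  shows "\<exists>G. openin X G \<and> G \<inter> A \<noteq> {} \<and>
    ((\<exists>i\<in>I. \<forall>H. openin X H \<and> H \<subseteq> G \<and> H \<inter> A \<noteq> {} \<longrightarrow>
        (\<exists>x\<in>H \<inter> A. \<phi> x < lo i) \<and> (\<exists>y\<in>H \<inter> A. \<phi> y > hi i)) \<or>
     (\<forall>i\<in>I. \<not> ((\<exists>x\<in>G \<inter> A. \<phi> x < lo i) \<and> (\<exists>y\<in>G \<inter> A. \<phi> y > hi i))))"
  using \<open>finite I\<close>
proof (induction I)
  case empty
  show ?case using A by (intro exI[of _ "topspace X"]) auto
next
  case (insert j I)
  let ?P = "\<lambda>i H. (\<exists>x\<in>H \<inter> A. \<phi> x < lo i) \<and> (\<exists>y\<in>H \<inter> A. \<phi> y > hi i)"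
  obtain G where G: "openin X G" "G \<inter> A \<noteq> {}"
    "(\<exists>i\<in>I. \<forall>H. openin X H \<and> H \<subseteq> G \<and> H \<inter> A \<noteq> {} \<longrightarrow> ?P i H) \<or> (\<forall>i\<in>I. \<not> ?P i G)"
    using insert.IH by blast
  show ?case
  proof (cases "\<exists>H. openin X H \<and> H \<subseteq> G \<and> H \<inter> A \<noteq> {} \<and> \<not> ?P j H")
    case False
    then have "\<exists>i\<in>insert j I. \<forall>H. openin X H \<and> H \<subseteq> G \<and> H \<inter> A \<noteq> {} \<longrightarrow> ?P i H" by blast
    then show ?thesis using G(1,2) by (intro exI[of _ G] conjI disjI1)
  next
    case True
    then obtain H where H: "openin X H" "H \<subseteq> G" "H \<inter> A \<noteq> {}" "\<not> ?P j H" by blast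
    from G(3) show ?thesis
    proof
      assume "\<forall>i\<in>I. \<not> ?P i G"
      then have "\<forall>i\<in>insert j I. \<not> ?P i H" using H(2,4) by blast
      then show ?thesis using H(1,3) by (intro exI[of _ H] conjI disjI2)
    next
      assume "\<exists>i\<in>I. \<forall>H. openin X H \<and> H \<subseteq> G \<and> H \<inter> A \<noteq> {} \<longrightarrow> ?P i H"
      then have "\<exists>i\<in>insert j I. \<forall>H. openin X H \<and> H \<subseteq> G \<and> H \<inter> A \<noteq> {} \<longrightarrow> ?P i H" by blast
      then show ?thesis using G(1,2) by (intro exI[of _ G] conjI disjI1)
    qed
  qed
qed

text \<open>There is a nonempty set \<open>A\<close> such that \<open>\<phi>\<close> takes values at distance at least some \<open>\<delta> > 0\<close> on each nonempty
  relatively open subset of \<open>A\<close>, and so straddles there some gap of a grid of mesh \<open>\<delta> / 3\<close>. Since \<open>\<phi>\<close> is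
  bounded, finitely many gaps suffice, and after passing to a relatively open subset \<open>D\<close> of \<open>A\<close> one fixed gap is
  straddled everywhere.\<close>
lemma not_fragmented_imp_oscillation:
  assumes bdd: "\<And>x. x \<in> topspace X \<Longrightarrow> \<bar>\<phi> x\<bar> \<le> B"
    and nf: "\<not> fragmented X real_entourages \<phi>"
  shows "\<exists>a b D. a < b \<and> D \<noteq> {} \<and> D \<subseteq> topspace X \<and>
    (\<forall>H. openin X H \<and> H \<inter> D \<noteq> {} \<longrightarrow> (\<exists>x\<in>H \<inter> D. \<phi> x < a) \<and> (\<exists>y\<in>H \<inter> D. \<phi> y > b))"
proof -
  obtain A \<delta> where A: "A \<noteq> {}" "A \<subseteq> topspace X" and \<delta>: "\<delta> > 0"
    and no: "\<nexists>G. openin X G \<and> G \<inter> A \<noteq> {} \<and> (\<forall>x\<in>G \<inter> A. \<forall>y\<in>G \<inter> A. \<bar>\<phi> x - \<phi> y\<bar> < \<delta>)"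
    using nf unfolding fragmented_real_iff by metis
  have osc: "\<exists>x\<in>G \<inter> A. \<exists>y\<in>G \<inter> A. \<phi> y \<ge> \<phi> x + \<delta>" if G: "openin X G" "G \<inter> A \<noteq> {}" for G
  proof -
    obtain x y where "x \<in> G \<inter> A" "y \<in> G \<inter> A" "\<not> \<bar>\<phi> x - \<phi> y\<bar> < \<delta>"
      using no G by metis
    then show ?thesis by (cases "\<phi> x \<le> \<phi> y") (force+)
  qed
  \<comment> \<open>With this mesh, a whole gap of the grid lies strictly between any two values that differ by \<open>\<delta>\<close>.\<close>
  define h where "h = \<delta> / 3"
  have h: "h > 0" using \<delta> by (simp add: h_def)
  define I where "I = {1..\<lfloor>2 * B / h\<rfloor> + 1}"
  define lo hi where "lo i = real_of_int i * h - B" and "hi i = real_of_int (i + 1) * h - B" for i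
  have grid: "\<exists>i\<in>I. s < lo i \<and> hi i < t" if "s \<ge> - B" "s \<le> B" "t \<ge> s + \<delta>" for s t
  proof
    let ?i = "\<lfloor>(s + B) / h\<rfloor> + 1"
    have 1: "real_of_int (\<lfloor>(s + B) / h\<rfloor>) * h \<le> s + B" and 2: "s + B < (real_of_int \<lfloor>(s + B) / h\<rfloor> + 1) * h"
      using h floor_divide_lower[OF h] floor_divide_upper[OF h] by blast+
    show "?i \<in> I"
      using that h unfolding I_def by (auto intro!: floor_mono divide_right_mono)
    have "hi ?i = real_of_int (\<lfloor>(s + B) / h\<rfloor>) * h + 2 * h - B" by (simp add: hi_def algebra_simps)
    then show "s < lo ?i \<and> hi ?i < t" using 1 2 that(3) \<delta> by (simp add: lo_def h_def)
  qed
  obtain G where G: "openin X G" "G \<inter> A \<noteq> {}"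
    "(\<exists>i\<in>I. \<forall>H. openin X H \<and> H \<subseteq> G \<and> H \<inter> A \<noteq> {} \<longrightarrow>
        (\<exists>x\<in>H \<inter> A. \<phi> x < lo i) \<and> (\<exists>y\<in>H \<inter> A. \<phi> y > hi i)) \<or>
     (\<forall>i\<in>I. \<not> ((\<exists>x\<in>G \<inter> A. \<phi> x < lo i) \<and> (\<exists>y\<in>G \<inter> A. \<phi> y > hi i)))"
    using straddling_open_set[of I A X \<phi> lo hi] A by (auto simp: I_def)
  obtain x y where xy: "x \<in> G \<inter> A" "y \<in> G \<inter> A" "\<phi> y \<ge> \<phi> x + \<delta>"
    using osc[OF G(1,2)] by metis
  have "\<bar>\<phi> x\<bar> \<le> B" using bdd xy(1) A by blast
  then have straddle: "\<exists>i\<in>I. \<phi> x < lo i \<and> hi i < \<phi> y" using grid[of "\<phi> x" "\<phi> y"] xy(3) by linarith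
  obtain i where
    Gi: "\<And>H. openin X H \<Longrightarrow> H \<subseteq> G \<Longrightarrow> H \<inter> A \<noteq> {} \<Longrightarrow>
        (\<exists>x\<in>H \<inter> A. \<phi> x < lo i) \<and> (\<exists>y\<in>H \<inter> A. \<phi> y > hi i)"
    using G(3)
  proof
    assume "\<forall>i\<in>I. \<not> ((\<exists>x\<in>G \<inter> A. \<phi> x < lo i) \<and> (\<exists>y\<in>G \<inter> A. \<phi> y > hi i))"
    then have "\<not> (\<phi> x < lo i \<and> hi i < \<phi> y)" if "i \<in> I" for i using xy(1,2) that by meson
    with straddle show ?thesis by metis
  qed (use that in metis)
  have "(\<exists>x\<in>H \<inter> (G \<inter> A). \<phi> x < lo i) \<and> (\<exists>y\<in>H \<inter> (G \<inter> A). \<phi> y > hi i)"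
    if "openin X H" "H \<inter> (G \<inter> A) \<noteq> {}" for H
    using Gi[OF openin_Int[OF that(1) G(1)]] that(2) by (simp add: Int_assoc)
  moreover have "lo i < hi i" using h by (simp add: lo_def hi_def algebra_simps)
  ultimately show ?thesis using G(2) A(2)
    by (intro exI[of _ "lo i"] exI[of _ "hi i"] exI[of _ "G \<inter> A"]) auto
qed

lemma openin_Collect_ball_finite:
  assumes "finite I" "\<And>i. i \<in> I \<Longrightarrow> openin X {x \<in> topspace X. P i x}"
  shows "openin X {x \<in> topspace X. \<forall>i\<in>I. P i x}"
  using assms
proof (induction I)
  case (insert j I)
  have "{x \<in> topspace X. \<forall>i\<in>insert j I. P i x} =
      {x \<in> topspace X. P j x} \<inter> {x \<in> topspace X. \<forall>i\<in>I. P i x}" by auto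
  moreover have "openin X {x \<in> topspace X. P j x}" by (rule insert.prems) simp
  moreover have "openin X {x \<in> topspace X. \<forall>i\<in>I. P i x}"
    by (rule insert.IH, rule insert.prems) simp
  ultimately show ?case by (simp only: openin_Int)
qed simp

text \<open>The sequence is built recursively. The points realizing a pattern of the functions
  found so far form an open set that meets \<open>D\<close>, so it contains both a point where \<open>\<phi>\<close> is small and one
  where \<open>\<phi>\<close> is large. There are finitely many patterns, and an element of \<open>F\<close> that imitates \<open>\<phi>\<close> at all these points is a
  possible next function.\<close>
lemma oscillating_limit_imp_independent:
  assumes ab: "a < b" and D: "D \<noteq> {}" "D \<subseteq> topspace X"
    and osc: "\<And>H. openin X H \<Longrightarrow> H \<inter> D \<noteq> {} \<Longrightarrow> (\<exists>x\<in>H \<inter> D. \<phi> x < a) \<and> (\<exists>y\<in>H \<inter> D. \<phi> y > b)"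
    and cont: "\<And>h. h \<in> F \<Longrightarrow> continuous_map X euclideanreal h"
    and approx: "\<And>K. finite K \<Longrightarrow> K \<subseteq> topspace X \<Longrightarrow>
      \<exists>h\<in>F. \<forall>x\<in>K. (\<phi> x < a \<longrightarrow> h x < a) \<and> (\<phi> x > b \<longrightarrow> h x > b)"
  shows "\<exists>h. range h \<subseteq> F \<and>
    (\<forall>n S. \<exists>x\<in>topspace X. \<forall>i<n::nat. if i \<in> S then h i x < a else h i x > b)"
proof -
  define pat where "pat h S i x \<longleftrightarrow> (if i \<in> S then h x < a else h x > b)"
    for h :: "'a \<Rightarrow> real" and S and i :: nat and x
  have "\<exists>f. \<forall>n. f n \<in> F \<and> (\<forall>S. \<exists>x\<in>D. (\<forall>i<n. pat (f i) S i x) \<and> pat (f n) S n x)"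
  proof (rule dependent_wf_choice[where R = less_than and
        P = "\<lambda>f n r. r \<in> F \<and> (\<forall>S. \<exists>x\<in>D. (\<forall>i<n. pat (f i) S i x) \<and> pat r S n x)"])
    show "wf less_than" by simp
  next
    fix f g :: "nat \<Rightarrow> 'a \<Rightarrow> real" and n r
    assume "\<And>m. (m, n) \<in> less_than \<Longrightarrow> f m = g m"
    then show "(r \<in> F \<and> (\<forall>S. \<exists>x\<in>D. (\<forall>i<n. pat (f i) S i x) \<and> pat r S n x)) =
        (r \<in> F \<and> (\<forall>S. \<exists>x\<in>D. (\<forall>i<n. pat (g i) S i x) \<and> pat r S n x))" by simp
  next
    fix n and f :: "nat \<Rightarrow> 'a \<Rightarrow> real"
    assume "\<And>m. (m, n) \<in> less_than \<Longrightarrow>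
      f m \<in> F \<and> (\<forall>S. \<exists>x\<in>D. (\<forall>i<m. pat (f i) S i x) \<and> pat (f m) S m x)"
    then have IH: "f m \<in> F" "\<exists>x\<in>D. (\<forall>i<m. pat (f i) S i x) \<and> pat (f m) S m x" if "m < n" for m S
      using that by auto
    have IH': "\<exists>x\<in>D. \<forall>i<n. pat (f i) S i x" for S
    proof (cases n)
      case (Suc m)
      then show ?thesis using IH(2)[of m S] less_Suc_eq by auto
    qed (use D in auto)
    define U where "U S = {x \<in> topspace X. \<forall>i\<in>{..<n}. pat (f i) S i x}" for S
    have "openin X {x \<in> topspace X. pat (f i) S i x}" if "i < n" for i S
    proof -
      have "openin X {x \<in> topspace X. f i x \<in> (if i \<in> S then {..<a} else {b<..})}"
        using cont[OF IH(1)[OF that]] by (intro openin_continuous_map_preimage) auto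
      moreover have "{x \<in> topspace X. f i x \<in> (if i \<in> S then {..<a} else {b<..})} =
          {x \<in> topspace X. pat (f i) S i x}" by (auto simp: pat_def)
      ultimately show ?thesis by simp
    qed
    then have "openin X (U S)" for S
      unfolding U_def by (intro openin_Collect_ball_finite) auto
    moreover have "U S \<inter> D \<noteq> {}" for S using IH'[of S] D(2) by (auto simp: U_def)
    ultimately have "\<exists>x\<in>U S \<inter> D. pat \<phi> S n x" for S
      using osc[of "U S"] by (auto simp: pat_def)
    then obtain x where x: "\<And>S. x S \<in> U S \<inter> D" "\<And>S. pat \<phi> S n (x S)" by metis
    obtain h where h: "h \<in> F" "\<forall>y\<in>x ` Pow {..n}. (\<phi> y < a \<longrightarrow> h y < a) \<and> (\<phi> y > b \<longrightarrow> h y > b)"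
      using approx[of "x ` Pow {..n}"] x(1) D(2) by auto
    have "\<exists>y\<in>D. (\<forall>i<n. pat (f i) S i y) \<and> pat h S n y" for S
    proof -
      \<comment> \<open>Only membership of indices up to \<open>n\<close> matters, which makes the set of patterns finite.\<close>
      let ?y = "x (S \<inter> {..n})"
      have y: "pat \<phi> (S \<inter> {..n}) n ?y" "?y \<in> U (S \<inter> {..n})" "?y \<in> D" using x by auto
      have "?y \<in> x ` Pow {..n}" by auto
      with h(2) have "\<phi> ?y < a \<longrightarrow> h ?y < a" "\<phi> ?y > b \<longrightarrow> h ?y > b" by blast+
      with y(1,2) have "pat h S n ?y" "\<forall>i<n. pat (f i) S i ?y"
        by (simp_all add: pat_def U_def split: if_splits)
      then show ?thesis using \<open>?y \<in> D\<close> by blast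
    qed
    then show "\<exists>r. r \<in> F \<and> (\<forall>S. \<exists>x\<in>D. (\<forall>i<n. pat (f i) S i x) \<and> pat r S n x)"
      using h(1) by blast
  qed
  then obtain f where f: "\<And>n. f n \<in> F"
    "\<And>n S. \<exists>x\<in>D. (\<forall>i<n. pat (f i) S i x) \<and> pat (f n) S n x" by blast
  have "\<exists>x\<in>topspace X. \<forall>i<n. if i \<in> S then f i x < a else f i x > b" for n S
    using f(2)[of n S] D(2) unfolding pat_def by blast
  then show ?thesis using f(1) by (intro exI[of _ f]) auto
qed

section \<open>Irreducible restrictions of continuous maps\<close>

text \<open>By compactness, the closed sets with the same image as the whole space are stable under intersections of
  chains, so there is a minimal one, \<open>M\<close>. If \<open>G\<close> meets \<open>M\<close>, then \<open>M - G\<close> has a strictly smaller image, and the complement of that compact image is the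
  required open set.\<close>
lemma irreducible_closed_subset:
  assumes X: "compact_space X" and Y: "Hausdorff_space Y" and q: "continuous_map X Y q"
  shows "\<exists>M. closedin X M \<and> q ` M = q ` topspace X \<and>
    (\<forall>G. openin X G \<and> G \<inter> M \<noteq> {} \<longrightarrow>
      (\<exists>W. openin Y W \<and> W \<inter> q ` topspace X \<noteq> {} \<and> W \<inter> q ` topspace X \<subseteq> q ` (G \<inter> M)))"
proof -
  define T where "T = q ` topspace X"
  have TY: "T \<subseteq> topspace Y" unfolding T_def by (rule continuous_map_image_subset_topspace[OF q])
  define \<A> where "\<A> = {M. closedin X M \<and> q ` M = T}"
  have "\<exists>M\<in>\<A>. \<forall>N\<in>\<A>. N \<subseteq> M \<longrightarrow> N = M"
  proof (rule predicate_Zorn)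
    show "partial_order_on \<A> (relation_of (\<lambda>M N. N \<subseteq> M) \<A>)"
      by (rule partial_order_on_relation_ofI) auto
    fix C assume C: "C \<in> Chains (relation_of (\<lambda>M N. N \<subseteq> M) \<A>)"
    then have CA: "M \<in> \<A>" if "M \<in> C" for M
      using that by (auto simp: Chains_def relation_of_def)
    have chain: "M \<subseteq> N \<or> N \<subseteq> M" if "M \<in> C" "N \<in> C" for M N
      using C that by (auto simp: Chains_def relation_of_def)
    show "\<exists>N\<in>\<A>. \<forall>M\<in>C. N \<subseteq> M"
    proof (cases "C = {}")
      case True
      then show ?thesis by (auto simp: \<A>_def T_def)
    next
      case False
      have "closedin X (\<Inter>C)" using False CA by (intro closedin_Inter) (auto simp: \<A>_def)
      moreover have "T \<subseteq> q ` \<Inter>C"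
      proof
        fix y assume y: "y \<in> T"
        define Q where "Q = {x \<in> topspace X. q x \<in> {y}}"
        have "closedin Y {y}" using Y y TY by (auto intro: closedin_Hausdorff_singleton)
        then have Q: "closedin X Q"
          unfolding Q_def by (rule closedin_continuous_map_preimage[OF q])
        have "\<Inter>((\<lambda>M. M \<inter> Q) ` C) \<noteq> {}"
        proof (rule X[unfolded compact_space_fip, rule_format], intro conjI ballI allI impI)
          fix Z assume "Z \<in> (\<lambda>M. M \<inter> Q) ` C"
          then show "closedin X Z" using CA Q by (auto simp: \<A>_def)
        next
          fix \<F> assume "finite \<F> \<and> \<F> \<subseteq> (\<lambda>M. M \<inter> Q) ` C"
          then obtain \<K> where K: "finite \<K>" "\<K> \<subseteq> C" "\<F> = (\<lambda>M. M \<inter> Q) ` \<K>"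
            by (meson finite_subset_image)
          show "\<Inter>\<F> \<noteq> {}"
          proof (cases "\<K> = {}")
            case False
            have "subset.chain C \<K>" using K(2) chain by (auto simp: subset.chain_def)
            then have "\<Inter>\<K> \<in> C" using Inter_in_chain[OF K(1) False] K(2) by blast
            then have "y \<in> q ` \<Inter>\<K>" using CA y by (auto simp: \<A>_def)
            then obtain x where "x \<in> \<Inter>\<K>" "q x = y" by blast
            moreover have "x \<in> topspace X"
              using \<open>x \<in> \<Inter>\<K>\<close> CA[OF \<open>\<Inter>\<K> \<in> C\<close>] closedin_subset unfolding \<A>_def by blast
            ultimately show ?thesis unfolding K(3) Q_def by auto
          qed (simp add: K(3))
        qed
        then show "y \<in> q ` \<Inter>C" using False by (auto simp: Q_def)
      qed
      moreover have "q ` \<Inter>C \<subseteq> T" using False CA by (auto simp: \<A>_def)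
      ultimately show ?thesis by (intro bexI[of _ "\<Inter>C"]) (auto simp: \<A>_def)
    qed
  qed
  then obtain M where M: "closedin X M" "q ` M = T"
    and min: "\<And>N. closedin X N \<Longrightarrow> q ` N = T \<Longrightarrow> N \<subseteq> M \<Longrightarrow> N = M"
    by (auto simp: \<A>_def)
  have W: "\<exists>W. openin Y W \<and> W \<inter> T \<noteq> {} \<and> W \<inter> T \<subseteq> q ` (G \<inter> M)"
    if G: "openin X G" "G \<inter> M \<noteq> {}" for G
  proof (intro exI conjI)
    let ?W = "topspace Y - q ` (M - G)"
    have cl: "closedin X (M - G)" using M(1) G(1) by blast
    then have "compactin Y (q ` (M - G))"
      using image_compactin[OF closedin_compact_space[OF X] q] by blast
    then show "openin Y ?W" using compactin_imp_closedin[OF Y] by blast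
    have "q ` (M - G) \<noteq> T" using min[OF cl] G(2) by blast
    then show "?W \<inter> T \<noteq> {}" using M(2) TY by blast
    show "?W \<inter> T \<subseteq> q ` (G \<inter> M)" using M(2) by blast
  qed
  show ?thesis
    unfolding T_def[symmetric] by (intro exI[of _ M] conjI allI impI M W) auto
qed

section \<open>The enveloping semigroup of the dual ball\<close>

lemma env_semigroup_eq:
  "env_semigroup V = self_maps dual_ball closure_of
    ((\<lambda>T. restrict (adjoint_action T) (cball 0 1)) ` {T. norm T \<le> 1})"
  by (simp add: env_semigroup_def enveloping_semigroup_def topspace_Theta topspace_dual_ball)

lemma topspace_env_topology: "topspace (env_topology V) = env_semigroup V"
  using closure_of_subset_topspace unfolding env_topology_def env_semigroup_eq by fastforce

lemma env_semigroup_maps: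
  fixes f :: "'a::real_normed_vector \<Rightarrow>\<^sub>L real"
  assumes "p \<in> env_semigroup TYPE('a)"
  shows "p \<in> extensional (cball 0 1)" and "norm f \<le> 1 \<Longrightarrow> norm (p f) \<le> 1"
proof -
  have "p \<in> topspace (self_maps (dual_ball :: ('a \<Rightarrow>\<^sub>L real) topology))"
    using subsetD[OF closure_of_subset_topspace] assms unfolding env_semigroup_eq .
  then show "p \<in> extensional (cball 0 1)" and "norm f \<le> 1 \<Longrightarrow> norm (p f) \<le> 1"
    by (auto simp: topspace_dual_ball PiE_def Pi_def)
qed

lemma continuous_map_dual_ball_apply:
  "continuous_map dual_ball euclideanreal (\<lambda>f. blinfun_apply f v)"
  using continuous_map_dual_ball[of dual_ball "\<lambda>f :: 'a \<Rightarrow>\<^sub>L real. f"] by simp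

lemma continuous_map_env_apply:
  fixes f :: "'a::real_normed_vector \<Rightarrow>\<^sub>L real"
  assumes "norm f \<le> 1"
  shows "continuous_map (env_topology TYPE('a)) dual_ball (\<lambda>p. p f)"
    "continuous_map (env_topology TYPE('a)) euclideanreal (\<lambda>p. blinfun_apply (p f) v)"
proof -
  show *: "continuous_map (env_topology TYPE('a)) dual_ball (\<lambda>p. p f)"
    unfolding env_topology_def using assms
    by (intro continuous_map_from_subtopology continuous_map_product_projection)
      (simp add: topspace_dual_ball)
  show "continuous_map (env_topology TYPE('a)) euclideanreal (\<lambda>p. blinfun_apply (p f) v)"
    using continuous_map_compose[OF * continuous_map_dual_ball_apply[of v]] by (simp add: o_def)
qed

lemma fragmented_dual_ball_iff:
  fixes f :: "'x \<Rightarrow> 'b::real_normed_vector \<Rightarrow>\<^sub>L real"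
  assumes "f \<in> topspace X \<rightarrow> cball 0 1"
  shows "fragmented X (compact_uniformity dual_ball) f \<longleftrightarrow>
    (\<forall>v. fragmented X real_entourages (\<lambda>x. blinfun_apply (f x) v))"
proof -
  have "fragmented X (compact_uniformity dual_ball) f \<longleftrightarrow>
      (\<forall>\<phi>\<in>range (\<lambda>v f. blinfun_apply f v). fragmented X real_entourages (\<lambda>x. \<phi> (f x)))"
  proof (rule fragmented_iff_separating[OF compact_dual_ball Hausdorff_dual_ball])
    show "f \<in> topspace X \<rightarrow> topspace dual_ball" using assms by (simp add: topspace_dual_ball)
    show "\<exists>\<phi>\<in>range (\<lambda>v f. blinfun_apply f v). \<phi> g \<noteq> \<phi> h" if ne: "g \<noteq> h" for g h :: "'b \<Rightarrow>\<^sub>L real"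
    proof -
      obtain v where "blinfun_apply g v \<noteq> blinfun_apply h v" using ne by (meson blinfun_eqI)
      then show ?thesis by (intro bexI[of _ "\<lambda>f. blinfun_apply f v"]) auto
    qed
  qed (auto simp: continuous_map_dual_ball_apply)
  then show ?thesis by simp
qed

lemma fragmented_env_iff:
  fixes F :: "'x \<Rightarrow> ('a::real_normed_vector \<Rightarrow>\<^sub>L real) \<Rightarrow> 'a \<Rightarrow>\<^sub>L real"
  assumes "F \<in> topspace X \<rightarrow> env_semigroup TYPE('a)"
  shows "fragmented X (compact_uniformity (env_topology TYPE('a))) F \<longleftrightarrow>
    (\<forall>f\<in>cball 0 1. \<forall>v. fragmented X real_entourages (\<lambda>x. blinfun_apply (F x f) v))"
proof -
  let ?\<Phi> = "(\<lambda>(f, v) p. blinfun_apply (p f) v) ` (cball 0 1 \<times> UNIV)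
    :: ((('a \<Rightarrow>\<^sub>L real) \<Rightarrow> 'a \<Rightarrow>\<^sub>L real) \<Rightarrow> real) set"
  have "\<exists>\<phi>\<in>?\<Phi>. \<phi> p \<noteq> \<phi> q" if p: "p \<in> env_semigroup TYPE('a)" and q: "q \<in> env_semigroup TYPE('a)"
    and "p \<noteq> q" for p q
  proof -
    obtain f where "f \<in> cball 0 1" "p f \<noteq> q f"
      using extensionalityI[OF env_semigroup_maps(1)[OF p] env_semigroup_maps(1)[OF q]] \<open>p \<noteq> q\<close> by blast
    moreover then obtain v where "blinfun_apply (p f) v \<noteq> blinfun_apply (q f) v"
      by (meson blinfun_eqI)
    ultimately show ?thesis by force
  qed
  then have "fragmented X (compact_uniformity (env_topology TYPE('a))) F \<longleftrightarrow>
      (\<forall>\<phi>\<in>?\<Phi>. fragmented X real_entourages (\<lambda>x. \<phi> (F x)))"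
    using assms
    by (intro fragmented_iff_separating env_semigroup_admissible)
      (auto simp: topspace_env_topology continuous_map_env_apply)
  then show ?thesis by auto
qed

text \<open>An element of the enveloping semigroup is a pointwise limit of adjoints, so \<open>f \<mapsto> p f v\<close> is imitated at
  finitely many \<open>f\<close> by evaluation at \<open>w = T v\<close> for some contraction \<open>T\<close>.\<close>
lemma env_semigroup_approx:
  fixes K :: "('a::real_normed_vector \<Rightarrow>\<^sub>L real) set"
  assumes p: "p \<in> env_semigroup TYPE('a)" and K: "finite K" "K \<subseteq> cball 0 1"
  shows "\<exists>w. norm w \<le> norm v \<and> (\<forall>f\<in>K.
    (blinfun_apply (p f) v < a \<longrightarrow> blinfun_apply f w < a) \<and>
    (blinfun_apply (p f) v > b \<longrightarrow> blinfun_apply f w > b))"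
proof -
  let ?X = "self_maps (dual_ball :: ('a \<Rightarrow>\<^sub>L real) topology)"
  define P where "P q f \<longleftrightarrow> (blinfun_apply (p f) v < a \<longrightarrow> blinfun_apply (q f) v < a) \<and>
    (blinfun_apply (p f) v > b \<longrightarrow> blinfun_apply (q f) v > b)" for q f
  define O1 where "O1 = {q \<in> topspace ?X. \<forall>f\<in>K. P q f}"
  have "openin ?X {q \<in> topspace ?X. P q f}" if "f \<in> K" for f
  proof -
    define U where "U = {t. (blinfun_apply (p f) v < a \<longrightarrow> t < a) \<and> (blinfun_apply (p f) v > b \<longrightarrow> t > b)}"
    have "open U" unfolding U_def
      by (intro open_Collect_conj open_Collect_imp open_Collect_less closed_Collect_const continuous_intros)
    moreover have "continuous_map ?X euclideanreal (\<lambda>q. blinfun_apply (q f) v)"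
    proof -
      have "continuous_map ?X dual_ball (\<lambda>q. q f)"
        using that K(2) by (intro continuous_map_product_projection) (auto simp: topspace_dual_ball)
      from continuous_map_compose[OF this continuous_map_dual_ball_apply[of v]]
      show ?thesis by (simp add: o_def)
    qed
    ultimately have "openin ?X {q \<in> topspace ?X. blinfun_apply (q f) v \<in> U}"
      by (intro openin_continuous_map_preimage) auto
    then show ?thesis by (simp add: U_def P_def)
  qed
  then have "openin ?X O1" unfolding O1_def by (rule openin_Collect_ball_finite[OF K(1)])
  moreover have "p \<in> O1"
    using subsetD[OF closure_of_subset_topspace p[unfolded env_semigroup_eq]] by (simp only: O1_def P_def) simp
  ultimately obtain T :: "'a \<Rightarrow>\<^sub>L 'a" where T: "norm T \<le> 1" "restrict (adjoint_action T) (cball 0 1) \<in> O1"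
    using p unfolding env_semigroup_eq in_closure_of by blast
  have "norm (T v) \<le> norm v"
    using order_trans[OF norm_blinfun[of T v] mult_right_mono[OF T(1) norm_ge_zero]] by simp
  moreover have "P (\<lambda>f. f o\<^sub>L T) f" if "f \<in> K" for f
  proof -
    have "norm f \<le> 1" using that K(2) by auto
    moreover have "P (restrict (adjoint_action T) (cball 0 1)) f"
      using T(2) that unfolding O1_def by blast
    ultimately show ?thesis by (simp add: P_def adjoint_action_def)
  qed
  ultimately show ?thesis by (intro exI[of _ "T v"]) (simp add: P_def)
qed

section \<open>The cycle of implications\<close>

text \<open>If \<open>p\<close> is not fragmented, neither is \<open>f \<mapsto> p f v\<close> for some \<open>v\<close>. This function is bounded by \<open>\<parallel>v\<parallel>\<close> and is
  a pointwise limit of evaluations at vectors of norm at most \<open>\<parallel>v\<parallel>\<close>, some sequence of which is therefore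
  independent and spans a copy of \<open>l\<^sub>1\<close>.\<close>
lemma rosenthal_imp_fragmented:
  assumes V: "rosenthal_space TYPE('a::banach)" and p: "p \<in> env_semigroup TYPE('a)"
  shows "fragmented dual_ball (compact_uniformity dual_ball) p"
proof (rule ccontr)
  assume nf: "\<not> ?thesis"
  have "p \<in> topspace dual_ball \<rightarrow> cball 0 1" using env_semigroup_maps(2)[OF p] by (auto simp: topspace_dual_ball)
  from fragmented_dual_ball_iff[OF this] nf obtain v where
    v: "\<not> fragmented dual_ball real_entourages (\<lambda>f. blinfun_apply (p f) v)" by blast
  have bdd: "\<bar>blinfun_apply (p f) v\<bar> \<le> norm v" if "f \<in> topspace dual_ball" for f
  proof -
    have "norm (p f) \<le> 1" using env_semigroup_maps(2)[OF p] that by (simp add: topspace_dual_ball)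
    then show ?thesis
      using order_trans[OF norm_blinfun[of "p f" v] mult_right_mono[OF _ norm_ge_zero[of v], of _ 1]] by simp
  qed
  obtain a b D where ab: "a < b" and D: "D \<noteq> {}" "D \<subseteq> topspace dual_ball"
    and osc: "\<And>H. openin dual_ball H \<Longrightarrow> H \<inter> D \<noteq> {} \<Longrightarrow>
      (\<exists>f\<in>H \<inter> D. blinfun_apply (p f) v < a) \<and> (\<exists>f\<in>H \<inter> D. blinfun_apply (p f) v > b)"
    using not_fragmented_imp_oscillation[OF bdd v] by metis
  define F where "F = (\<lambda>w (f :: 'a \<Rightarrow>\<^sub>L real). blinfun_apply f w) ` cball 0 (norm v)"
  have "\<exists>h. range h \<subseteq> F \<and>
    (\<forall>n S. \<exists>f\<in>topspace dual_ball. \<forall>i<n::nat. if i \<in> S then h i f < a else h i f > b)"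
  proof (rule oscillating_limit_imp_independent[OF ab D osc])
    show "continuous_map dual_ball euclideanreal h" if "h \<in> F" for h
      using that by (auto simp: F_def continuous_map_dual_ball_apply)
    show "\<exists>h\<in>F. \<forall>f\<in>K. (blinfun_apply (p f) v < a \<longrightarrow> h f < a) \<and> (blinfun_apply (p f) v > b \<longrightarrow> h f > b)"
      if "finite K" "K \<subseteq> topspace dual_ball" for K
      using env_semigroup_approx[OF p that(1), of v a b] that(2) by (auto simp: F_def topspace_dual_ball)
  qed auto
  then obtain h where hF: "range h \<subseteq> F" and
    h: "\<And>n S. \<exists>f\<in>topspace dual_ball. \<forall>i<n::nat. if i \<in> S then h i f < a else h i f > b" by blast
  have "\<forall>i. \<exists>w. norm w \<le> norm v \<and> h i = (\<lambda>f. blinfun_apply f w)"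
    using hF by (force simp: F_def)
  then obtain w where w: "\<And>i. norm (w i) \<le> norm v" "\<And>i. h i = (\<lambda>f. blinfun_apply f (w i))" by metis
  have "\<exists>f :: 'a \<Rightarrow>\<^sub>L real. norm f \<le> 1 \<and>
      (\<forall>i<n. if i \<in> S then blinfun_apply f (w i) < a else blinfun_apply f (w i) > b)" for n S
    using h[of n S] unfolding w(2) topspace_dual_ball Bex_def by simp
  then have "contains_l1 TYPE('a)" by (rule independent_functionals_imp_contains_l1[OF w(1) ab])
  then show False using V by (simp add: rosenthal_space_def)
qed

text \<open>The coordinate \<open>x \<mapsto> (a \<circ> x) f\<close> of a left translation is the fragmented map \<open>a\<close> after the continuous
  evaluation \<open>x \<mapsto> x f\<close>.\<close>
lemma fragmented_imp_tame_semigroup: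
  assumes fr: "\<And>p. p \<in> env_semigroup TYPE('a::real_normed_vector) \<Longrightarrow>
    fragmented dual_ball (compact_uniformity dual_ball) p"
  shows "tame_semigroup (env_topology TYPE('a)) (compose (topspace dual_ball))"
  unfolding tame_semigroup_def
proof (intro conjI ballI env_semigroup_admissible)
  fix a assume "a \<in> topspace (env_topology TYPE('a))"
  then have a: "a \<in> env_semigroup TYPE('a)" by (simp add: topspace_env_topology)
  have clos: "compose (topspace dual_ball) a \<in> topspace (env_topology TYPE('a)) \<rightarrow> env_semigroup TYPE('a)"
    using env_semigroup_admissible(3)[of "TYPE('a)"] a
    unfolding admissible_semigroup_def right_topological_semigroup_def
    by (auto simp: topspace_env_topology)
  have "fragmented (env_topology TYPE('a)) real_entourages
      (\<lambda>x. blinfun_apply (compose (topspace dual_ball) a x f) v)" if f: "f \<in> cball 0 1" for f v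
  proof -
    have "a \<in> topspace dual_ball \<rightarrow> cball 0 1"
      using env_semigroup_maps(2)[OF a] by (auto simp: topspace_dual_ball)
    then have "fragmented dual_ball real_entourages (\<lambda>g. blinfun_apply (a g) v)"
      using fr[OF a] fragmented_dual_ball_iff by blast
    then have "fragmented (env_topology TYPE('a)) real_entourages (\<lambda>x. blinfun_apply (a (x f)) v)"
      using f by (intro fragmented_compose_continuous[OF continuous_map_env_apply(1)]) auto
    then show ?thesis using f by (simp add: compose_def topspace_dual_ball)
  qed
  then show "fragmented (env_topology TYPE('a)) (compact_uniformity (env_topology TYPE('a)))
      (compose (topspace dual_ball) a)"
    using fragmented_env_iff[OF clos] by blast
qed

text \<open>Let \<open>g\<close> be constantly \<open>c\<close> on the \<open>v\<^sub>n\<close>. The adjoint of the rank one operator \<open>x \<mapsto> g x \<cdot> v\<^sub>n\<close> maps \<open>f\<close> to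
  \<open>f v\<^sub>n \<cdot> g\<close>. Let \<open>p\<close> be a cluster point of these adjoints; then \<open>p f v\<^sub>0 = c \<cdot> lim f v\<^sub>n\<close> whenever \<open>f v\<^sub>n\<close> is
  eventually constant. The map \<open>q\<close> sending \<open>x\<close> to the sequence \<open>x g v\<^sub>n\<close> takes a closed subset \<open>A\<close> of the
  semigroup onto the Cantor set of all sequences of \<open>\<plusminus>d\<close>: a sign pattern realized by \<open>f\<close> comes from the
  adjoint of \<open>x \<mapsto> f x \<cdot> v\<^sub>0\<close>. On the irreducible closed subset \<open>M\<close> of \<open>A\<close>, a relatively open set has an
  image that contains a cylinder, hence sequences that are eventually \<open>d\<close> and sequences that are
  eventually \<open>- d\<close>. So the coordinate \<open>\<phi>\<close> of the left translation by \<open>p\<close> takes the values \<open>\<plusminus>c d\<close> on it.\<close>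
lemma sign_functionals_imp_not_tame_semigroup:
  fixes v :: "nat \<Rightarrow> 'a::real_normed_vector"
  assumes c: "c > 0" and v: "\<And>n. norm (v n) \<le> 1"
    and signs: "\<And>S. \<exists>f :: 'a \<Rightarrow>\<^sub>L real. norm f \<le> 1 \<and>
      (\<forall>n. blinfun_apply f (v n) = (if n \<in> S then c else - c))"
  shows "\<not> tame_semigroup (env_topology TYPE('a)) (compose (topspace dual_ball))"
proof
  assume tame: "tame_semigroup (env_topology TYPE('a)) (compose (topspace dual_ball))"
  let ?E = "env_topology TYPE('a)" and ?B = "cball 0 1 :: ('a \<Rightarrow>\<^sub>L real) set"
  obtain g :: "'a \<Rightarrow>\<^sub>L real" where g: "norm g \<le> 1" "\<And>n. blinfun_apply g (v n) = c"
    using signs[of UNIV] by auto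
  define rk where "rk f u = blinfun_scaleR_left u o\<^sub>L f" for f :: "'a \<Rightarrow>\<^sub>L real" and u :: 'a
  define R where "R f u = restrict (adjoint_action (rk f u)) ?B" for f :: "'a \<Rightarrow>\<^sub>L real" and u :: 'a
  have rk: "norm (rk f u) \<le> 1" if f: "norm f \<le> 1" and u: "norm u \<le> 1" for f u
  proof -
    have "\<bar>blinfun_apply f x\<bar> * norm u \<le> norm x" for x
      using mult_mono[OF order_trans[OF norm_blinfun[of f x] mult_right_mono[OF f norm_ge_zero]] u] by simp
    then show ?thesis unfolding rk_def by (intro norm_blinfun_bound) auto
  qed
  have R_in: "R f u \<in> topspace ?E" if "norm f \<le> 1" "norm u \<le> 1" for f u
  proof -
    have "(\<lambda>T. restrict (adjoint_action T) ?B) ` {T. norm T \<le> 1} \<subseteq>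
        topspace (self_maps (dual_ball :: ('a \<Rightarrow>\<^sub>L real) topology))"
      by (auto simp: topspace_dual_ball adjoint_action_def norm_compose_le_1)
    from closure_of_subset[OF this] show ?thesis
      using rk[OF that] unfolding topspace_env_topology env_semigroup_eq R_def by blast
  qed
  have R_apply: "blinfun_apply (R f u h) x = blinfun_apply f x * blinfun_apply h u" if "norm h \<le> 1" for f u h x
    using that by (simp add: R_def rk_def adjoint_action_def blinfun.scaleR_right)
  define Cl where "Cl n = ?E closure_of ((\<lambda>k. R g (v k)) ` {n..})" for n
  have "(\<Inter>n. Cl n) \<noteq> {}"
  proof (rule compact_space_imp_nest[OF env_semigroup_admissible(1)])
    show "closedin ?E (Cl n)" for n by (simp add: Cl_def)
    have "R g (v n) \<in> Cl n" for n
      unfolding Cl_def using R_in[OF g(1) v]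
        closure_of_subset[of "(\<lambda>k. R g (v k)) ` {n..}" ?E] by blast
    then show "Cl n \<noteq> {}" for n by blast
    show "decseq Cl"
      unfolding decseq_def Cl_def by (intro allI impI closure_of_mono image_mono) auto
  qed
  then obtain p where p: "\<And>n. p \<in> Cl n" by blast
  have pE: "p \<in> topspace ?E" using subsetD[OF closure_of_subset_topspace p[of 0, unfolded Cl_def]] .
  have p_lim: "blinfun_apply (p f) (v 0) = c * t"
    if f: "norm f \<le> 1" and t: "\<And>k. k \<ge> n \<Longrightarrow> blinfun_apply f (v k) = t" for f n t
  proof -
    let ?Z = "{q \<in> topspace ?E. blinfun_apply (q f) (v 0) \<in> {c * t}}"
    have "closedin ?E ?Z"
      by (rule closedin_continuous_map_preimage[OF continuous_map_env_apply(2)[OF f]]) auto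
    moreover have "(\<lambda>k. R g (v k)) ` {n..} \<subseteq> ?Z"
      using R_in[OF g(1) v] by (auto simp: R_apply[OF f] g(2) t)
    ultimately have "Cl n \<subseteq> ?Z" unfolding Cl_def by (rule closure_of_minimal[rotated])
    then show ?thesis using p by blast
  qed
  define \<phi> where "\<phi> x = blinfun_apply (p (x g)) (v 0)" for x :: "('a \<Rightarrow>\<^sub>L real) \<Rightarrow> 'a \<Rightarrow>\<^sub>L real"
  have frag: "fragmented ?E real_entourages \<phi>"
  proof -
    have clos: "compose (topspace dual_ball) p \<in> topspace ?E \<rightarrow> env_semigroup TYPE('a)"
      using env_semigroup_admissible(3)[of "TYPE('a)"] pE
      unfolding admissible_semigroup_def right_topological_semigroup_def
      by (auto simp: topspace_env_topology)
    have "fragmented ?E (compact_uniformity ?E) (compose (topspace dual_ball) p)"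
      using tame pE unfolding tame_semigroup_def by blast
    then have "fragmented ?E real_entourages
        (\<lambda>x. blinfun_apply (compose (topspace dual_ball) p x g) (v 0))"
      using g(1) unfolding fragmented_env_iff[OF clos] by simp
    then show ?thesis using g(1) by (simp add: compose_def topspace_dual_ball \<phi>_def[abs_def])
  qed
  \<comment> \<open>One factor \<open>c\<close> is \<open>g v\<^sub>0\<close>, the other the modulus of the realized sign patterns.\<close>
  define d where "d = c * c"
  have d: "d > 0" using c by (simp add: d_def)
  define q where "q x n = blinfun_apply (x g) (v n)" for x :: "('a \<Rightarrow>\<^sub>L real) \<Rightarrow> 'a \<Rightarrow>\<^sub>L real" and n
  define Y :: "(nat \<Rightarrow> real) set" where "Y = {y. \<forall>n. y n \<in> {d, - d}}"
  define A where "A = {x \<in> topspace ?E. q x \<in> Y}"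
  have q: "continuous_map ?E euclidean q"
  proof -
    have "continuous_map ?E (product_topology (\<lambda>_. euclideanreal) UNIV) q"
      unfolding continuous_map_componentwise_UNIV q_def using continuous_map_env_apply(2)[OF g(1)] by blast
    then show ?thesis by (simp add: euclidean_product_topology)
  qed
  have "closed Y"
    unfolding Y_def insert_iff empty_iff simp_thms
    by (intro closed_Collect_all closed_Collect_disj closed_Collect_eq
        continuous_on_product_coordinates continuous_on_const)
  then have "closedin ?E A" unfolding A_def by (intro closedin_continuous_map_preimage[OF q]) simp
  then have cA: "compact_space (subtopology ?E A)"
    by (intro compact_space_subtopology closedin_compact_space[OF env_semigroup_admissible(1)])
  have tA: "topspace (subtopology ?E A) = A" by (auto simp: A_def)
  have onto: "y \<in> q ` A" if "y \<in> Y" for y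
  proof -
    obtain f :: "'a \<Rightarrow>\<^sub>L real" where f: "norm f \<le> 1"
      "\<And>n. blinfun_apply f (v n) = (if n \<in> {n. y n = d} then c else - c)"
      using signs[of "{n. y n = d}"] by blast
    have "q (R f (v 0)) n = y n" for n
      using that f(2)[of n] g(2) by (auto simp: Y_def q_def R_apply[OF g(1)] d_def)
    then have "q (R f (v 0)) = y" by blast
    then show ?thesis
      using R_in[OF f(1) v[of 0]] that by (intro image_eqI[of _ _ "R f (v 0)"]) (simp_all add: A_def)
  qed
  have qA: "q ` A = Y"
    using onto by (auto simp: A_def)
  have "continuous_map (subtopology ?E A) euclidean q" by (rule continuous_map_from_subtopology[OF q])
  from irreducible_closed_subset[OF cA _ this, unfolded tA qA]
  obtain M where M: "closedin (subtopology ?E A) M" "q ` M = Y"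
    and irr: "\<And>G. openin (subtopology ?E A) G \<Longrightarrow> G \<inter> M \<noteq> {} \<Longrightarrow>
      \<exists>W. open W \<and> W \<inter> Y \<noteq> {} \<and>
        W \<inter> Y \<subseteq> q ` (G \<inter> M)"
    by auto
  have MA: "M \<subseteq> A" using closedin_subset[OF M(1)] tA by blast
  have "(\<lambda>_. d) \<in> q ` M" unfolding M(2) by (simp add: Y_def)
  then have "M \<noteq> {} \<and> M \<subseteq> topspace ?E \<and> 2 * (c * d) > 0" using MA c d by (auto simp: A_def)
  then have "\<exists>G. openin ?E G \<and> G \<inter> M \<noteq> {} \<and>
      (\<forall>x\<in>G \<inter> M. \<forall>y\<in>G \<inter> M. \<bar>\<phi> x - \<phi> y\<bar> < 2 * (c * d))"
    by (rule frag[unfolded fragmented_real_iff, THEN spec, THEN spec, THEN mp])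
  then obtain G where G: "openin ?E G" "G \<inter> M \<noteq> {}"
    "\<forall>x\<in>G \<inter> M. \<forall>y\<in>G \<inter> M. \<bar>\<phi> x - \<phi> y\<bar> < 2 * (c * d)"
    by (elim exE conjE)
  have "openin (subtopology ?E A) (A \<inter> G)" by (simp add: G(1) openin_subtopology_Int2)
  moreover have "A \<inter> G \<inter> M \<noteq> {}" using G(2) MA by blast
  ultimately obtain W where W: "open W" "W \<inter> Y \<noteq> {}"
    "W \<inter> Y \<subseteq> q ` (A \<inter> G \<inter> M)"
    using irr by meson
  then obtain y where y: "y \<in> W" "y \<in> Y" by blast
  obtain N where N: "\<And>z. (\<And>n. n < N \<Longrightarrow> z n = y n) \<Longrightarrow> z \<in> W"
  proof -
    obtain X where X: "y \<in> Pi\<^sub>E UNIV X" "finite {i. X i \<noteq> UNIV}" "Pi\<^sub>E UNIV X \<subseteq> W"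
      using product_topology_open_contains_basis[of "\<lambda>_. euclideanreal" UNIV W y] W(1) y(1)
      by (auto simp: open_fun_def)
    obtain N where "{i. X i \<noteq> UNIV} \<subseteq> {..<N}"
      using X(2) finite_nat_bounded by blast
    then have XN: "X i = UNIV" if "i \<ge> N" for i
      using that by (metis (mono_tags) lessThan_iff mem_Collect_eq not_less subsetD)
    have "z \<in> W" if z: "\<And>n. n < N \<Longrightarrow> z n = y n" for z
    proof -
      have "z i \<in> X i" for i
        using XN[of i] z[of i] PiE_mem[OF X(1), of i] by (cases "i < N") auto
      then show ?thesis using X(3) by auto
    qed
    then show ?thesis by (rule that)
  qed
  have "\<exists>x\<in>G \<inter> M. \<phi> x = c * t" if "t \<in> {d, - d}" for t
  proof -
    define z where "z n = (if n < N then y n else t)" for n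
    have "z \<in> W \<inter> Y" using N[of z] y(2) that by (auto simp: z_def Y_def)
    then obtain x where x: "x \<in> A \<inter> G \<inter> M" "q x = z" using W(3) by blast
    have "norm (x g) \<le> 1"
      using x(1) env_semigroup_maps(2) g(1) by (auto simp: A_def topspace_env_topology)
    moreover have "blinfun_apply (x g) (v k) = t" if "k \<ge> N" for k
      using fun_cong[OF x(2), of k] that by (simp add: q_def z_def)
    ultimately have "\<phi> x = c * t" unfolding \<phi>_def by (rule p_lim)
    then show ?thesis using x(1) by blast
  qed
  then obtain x x' where "x \<in> G \<inter> M" "\<phi> x = c * d" "x' \<in> G \<inter> M" "\<phi> x' = c * - d" by blast
  then have "\<bar>c * d - c * - d\<bar> < 2 * (c * d)" using G(3) by metis
  then show False by simp
qed

theorem theorem6p18: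
  shows "(rosenthal_space TYPE('a::banach) \<longleftrightarrow>
            tame_system (Theta :: ('a \<Rightarrow>\<^sub>L 'a) topology) Theta_op_mult id_blinfun dual_ball adjoint_action)
       \<and> (tame_system (Theta :: ('a \<Rightarrow>\<^sub>L 'a) topology) Theta_op_mult id_blinfun dual_ball adjoint_action \<longleftrightarrow>
            (\<forall>p\<in>env_semigroup TYPE('a). fragmented dual_ball (compact_uniformity dual_ball) p))
       \<and> ((\<forall>p\<in>env_semigroup TYPE('a). fragmented dual_ball (compact_uniformity dual_ball) p) \<longleftrightarrow>
            tame_semigroup (env_topology TYPE('a)) (compose (topspace dual_ball)))"
proof -
  let ?frag = "\<forall>p\<in>env_semigroup TYPE('a). fragmented dual_ball (compact_uniformity dual_ball) p"
  let ?tame = "tame_semigroup (env_topology TYPE('a)) (compose (topspace dual_ball))"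
  have "tame_system (Theta :: ('a \<Rightarrow>\<^sub>L 'a) topology) Theta_op_mult id_blinfun dual_ball adjoint_action \<longleftrightarrow> ?frag"
    by (simp add: tame_system_def compact_system_Theta_op env_semigroup_def)
  moreover have "rosenthal_space TYPE('a) \<Longrightarrow> ?frag" using rosenthal_imp_fragmented by blast
  moreover have "?frag \<Longrightarrow> ?tame" using fragmented_imp_tame_semigroup by blast
  moreover have "?tame \<Longrightarrow> rosenthal_space TYPE('a)"
    using contains_l1_imp_sign_functionals[where 'a = 'a] sign_functionals_imp_not_tame_semigroup[where 'a = 'a]
    unfolding rosenthal_space_def by blast
  ultimately show ?thesis by blast
qed

end
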